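(* Let $\alpha:[0,1]\to[c,d]\subset(0,2)$ be continuously differentiable and let $Y$ be the symmetric multistable Lévy motion with parameter $\alpha$ on $(0,1)$, as defined in the context. Then for all $t\in(0,1)$, almost surely, $\mathcal{H}_t\le\frac1{\alpha(t)}$, where $$\mathcal{H}_t=\sup\Big\{\gamma:\lim_{r\to0}\frac{|Y(t+r)-Y(t)|}{|r|^\gamma}=0\Big\}$$ is the pointwise Hölder exponent of $Y$ at $t$.
   Context: Symmetric multistable Lévy motion: let $(\Gamma_i)_{i\ge1}$ be the arrival times of a Poisson process with unit rate, $(V_i)_{i\ge1}$ i.i.d. uniform on $[0,1]$, and $(\gamma_i)_{i\ge1}$ i.i.d. with $P(\gamma_i=1)=P(\gamma_i=-1)=1/2$, the three sequences being independent. With $C_\eta=\big(\int_0^\infty x^{-\eta}\sin x\,dx\big)^{-1}$, set $X(t,u)=C_{\alpha(u)}^{1/\alpha(u)}\sum_{i=1}^\infty\gamma_i\Gamma_i^{-1/\alpha(u)}\mathbf{1}_{[0,t]}(V_i)$ and $Y(t)=X(t,t)$. *)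

theory Defs
  imports "HOL-Probability.Probability"
begin

text \<open>
  Sequences are indexed from 0, so \<open>\<Gamma> i\<close>, \<open>V i\<close>, \<open>\<gamma> i\<close> stand for
  \<open>\<Gamma>\<close>, \<open>V\<close>, \<open>\<gamma>\<close> with mathematical index \<open>i + 1\<close>. In particular \<open>\<Gamma> 0\<close> is the
  first arrival time.
\<close>

definition interarrival :: "(nat \<Rightarrow> 'a \<Rightarrow> real) \<Rightarrow> nat \<Rightarrow> 'a \<Rightarrow> real" where
  "interarrival \<Gamma> i \<omega> = (case i of 0 \<Rightarrow> \<Gamma> 0 \<omega> | Suc j \<Rightarrow> \<Gamma> (Suc j) \<omega> - \<Gamma> j \<omega>)"

text \<open>
  A Poisson process is given here by its i.i.d. exponential waiting times.
\<close>

definition poisson_arrival_times :: "'a measure \<Rightarrow> real \<Rightarrow> (nat \<Rightarrow> 'a \<Rightarrow> real) \<Rightarrow> bool" where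
  "poisson_arrival_times M l \<Gamma> \<longleftrightarrow>
     prob_space.indep_vars M (\<lambda>_. borel) (interarrival \<Gamma>) UNIV \<and>
     (\<forall>i. distributed M lborel (interarrival \<Gamma> i) (exponential_density l))"

locale levy_series = prob_space M for M :: "'a measure" +
  fixes \<Gamma> V \<gamma> :: "nat \<Rightarrow> 'a \<Rightarrow> real"
  assumes arrival: "poisson_arrival_times M 1 \<Gamma>"
    and V_indep: "indep_vars (\<lambda>_. borel) V UNIV"
    and V_uniform: "\<And>i. distr M borel (V i) = uniform_measure lborel {0..1}"
    and \<gamma>_indep: "indep_vars (\<lambda>_. borel) \<gamma> UNIV"
    and \<gamma>_pos: "\<And>i. prob {\<omega> \<in> space M. \<gamma> i \<omega> = 1} = 1 / 2"
    and \<gamma>_neg: "\<And>i. prob {\<omega> \<in> space M. \<gamma> i \<omega> = - 1} = 1 / 2"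
    \<comment> \<open>independence of the three sequences, as random elements of the sequence space\<close>
    and sequences_indep:
      "indep_vars (\<lambda>_. PiM UNIV (\<lambda>_::nat. borel :: real measure))
         (\<lambda>k \<omega> i. ([\<Gamma>, V, \<gamma>] ! k) i \<omega>) {0, 1, 2}"

text \<open>
  For \<open>\<eta> \<le> 1\<close> the integral defining \<open>C\<^sub>\<eta>\<close> converges only conditionally. The
  Henstock-Kurzweil integral over the half-line covers this case, whereas the Lebesgue
  integral would be 0 by convention.
\<close>

definition stable_const :: "real \<Rightarrow> real" where
  "stable_const \<eta> = inverse (integral {0..} (\<lambda>x. x powr (- \<eta>) * sin x))"

definition multistable_field ::
    "(real \<Rightarrow> real) \<Rightarrow> (nat \<Rightarrow> 'a \<Rightarrow> real) \<Rightarrow> (nat \<Rightarrow> 'a \<Rightarrow> real) \<Rightarrow> (nat \<Rightarrow> 'a \<Rightarrow> real) \<Rightarrow>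
     real \<Rightarrow> real \<Rightarrow> 'a \<Rightarrow> real" where
  "multistable_field \<alpha> \<Gamma> V \<gamma> t u \<omega> =
     stable_const (\<alpha> u) powr (1 / \<alpha> u) *
     (\<Sum>i. \<gamma> i \<omega> * \<Gamma> i \<omega> powr (- (1 / \<alpha> u)) * indicator {0..t} (V i \<omega>))"

definition multistable_levy_motion ::
    "(real \<Rightarrow> real) \<Rightarrow> (nat \<Rightarrow> 'a \<Rightarrow> real) \<Rightarrow> (nat \<Rightarrow> 'a \<Rightarrow> real) \<Rightarrow> (nat \<Rightarrow> 'a \<Rightarrow> real) \<Rightarrow>
     real \<Rightarrow> 'a \<Rightarrow> real" where
  "multistable_levy_motion \<alpha> \<Gamma> V \<gamma> t \<omega> = multistable_field \<alpha> \<Gamma> V \<gamma> t t \<omega>"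

text \<open>
  The supremum is taken in the extended reals, since the set of admissible exponents may
  be empty or unbounded.
\<close>

definition pointwise_holder_exponent :: "(real \<Rightarrow> real) \<Rightarrow> real \<Rightarrow> ereal" where
  "pointwise_holder_exponent f t =
     Sup (ereal ` {h. ((\<lambda>r. \<bar>f (t + r) - f t\<bar> / \<bar>r\<bar> powr h) \<longlongrightarrow> 0) (at 0)})"

end

theory Submission
  imports Defs
begin

text \<open>
  Fix \<open>t\<close> and \<open>h > 1 / \<alpha> t\<close>, choose \<open>q < 1\<close> with \<open>q * h * \<alpha> t > 1\<close> and let
  \<open>r i = (1 - t) * (i + 1) powr - q\<close>. Since \<open>\<Sum>i. r i\<close> diverges, almost surely \<open>V i\<close> lies in
  \<open>{t<..t + r i}\<close> for infinitely many \<open>i\<close>; for large such \<open>i\<close>, reversing the sign \<open>\<gamma> i\<close> changes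
  \<open>Y (t + r i) - Y t\<close> by more than \<open>2 * r i powr h\<close>. Conditionally on \<open>\<Gamma>\<close> and \<open>V\<close>, the set of
  sign sequences with \<open>\<bar>Y (t + r n) - Y t\<bar> \<le> r n powr h\<close> for all \<open>n \<ge> m\<close> is therefore disjoint
  from its image under infinitely many single sign changes. But every measurable set of sign
  sequences is asymptotically invariant under changing the \<open>i\<close>-th sign as \<open>i\<close> tends to infinity,
  so this set is null.

  The argument needs the series to converge almost surely, because the value of \<open>suminf\<close> on a
  divergent series ignores sign changes. Convergence follows from Hoeffding's inequality for the
  partial sums of the signs and summation by parts against the decreasing \<open>\<Gamma> i powr - 1 / \<alpha> u\<close>.
\<close>

subsection \<open>Bounds on the normalising constant\<close>

text \<open>Improper integration without absolute convergence: once a box contains both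
  \<open>a\<close> and \<open>N\<close>, the integral of the truncated \<open>h\<close> over it
  equals \<open>k\<close> at its right endpoint, which is close to \<open>l\<close>.\<close>

lemma has_integral_half_lineI:
  fixes h :: "real \<Rightarrow> real"
  assumes int: "\<And>y. a \<le> y \<Longrightarrow> (h has_integral k y) {a..y}" and lim: "(k \<longlongrightarrow> l) at_top"
  shows "(h has_integral l) {a..}"
proof (subst has_integral', intro allI impI)
  fix e :: real assume "0 < e"
  then obtain N where N: "\<bar>k y - l\<bar> < e" if "N \<le> y" for y
    using tendstoD[OF lim \<open>0 < e\<close>] by (auto simp: eventually_at_top_linorder dist_real_def)
  show "\<exists>B>0. \<forall>c b. ball 0 B \<subseteq> cbox c b \<longrightarrow>
      (\<exists>z. ((\<lambda>x. if x \<in> {a..} then h x else 0) has_integral z) (cbox c b) \<and> norm (z - l) < e)"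
  proof (rule exI[of _ "\<bar>a\<bar> + \<bar>N\<bar> + 1"], intro conjI allI impI)
    fix c b :: real assume "ball 0 (\<bar>a\<bar> + \<bar>N\<bar> + 1) \<subseteq> cbox c b"
    moreover have "max a N \<in> ball 0 (\<bar>a\<bar> + \<bar>N\<bar> + 1)" "a \<in> ball 0 (\<bar>a\<bar> + \<bar>N\<bar> + 1)"
      by (simp_all add: dist_real_def)
    ultimately have "max a N \<in> cbox c b" "a \<in> cbox c b" by blast+
    then have cb: "c \<le> a" "a \<le> b" "N \<le> b" by auto
    have "((\<lambda>x. if x \<in> {a..b} then h x else 0) has_integral k b) {c..b}"
      using int[OF cb(2)] cb(1) has_integral_restrict[of "{a..b}" "{c..b}" h "k b"] by simp
    then have "((\<lambda>x. if x \<in> {a..} then h x else 0) has_integral k b) (cbox c b)"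
      unfolding cbox_interval by (rule has_integral_eq[rotated]) auto
    then show "\<exists>z. ((\<lambda>x. if x \<in> {a..} then h x else 0) has_integral z) (cbox c b) \<and> norm (z - l) < e"
      using N[OF cb(3)] by auto
  qed linarith
qed

text \<open>
  Integration by parts turns the conditionally convergent integral defining \<open>stable_const\<close> into
  an absolutely convergent one with nonnegative integrand.
\<close>

lemma stable_const_integral:
  fixes \<eta> :: real
  assumes \<eta>: "0 < \<eta>" "\<eta> < 2"
  defines "g \<equiv> \<lambda>x::real. (1 - cos x) * x powr (- \<eta> - 1)"
  shows integrable_one_minus_cos_powr: "g integrable_on {0..}"
    and integral_one_minus_cos_powr_pos: "0 < integral {0..} g"
    and integral_one_minus_cos_powr_le: "integral {0..} g \<le> 1 / (2 - \<eta>) + 2 / \<eta>"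
    and integral_sin_powr: "((\<lambda>x. x powr (- \<eta>) * sin x) has_integral (\<eta> * integral {0..} g)) {0..}"
proof -
  \<comment> \<open>Majorant of \<open>g\<close>: 1 - cos x is at most x^2 for small x and at most 2
    for large x. It is integrable at 0 because \<eta> < 2 and at infinity because 0 <
    \<eta>.\<close>
  define H where "H x = (if x \<le> 1 then x powr (1 - \<eta>) else 2 * x powr (- \<eta> - 1))" for x :: real
  have H01: "(H has_integral 1 / (2 - \<eta>)) {0..1}"
    using has_integral_powr_from_0[of "1 - \<eta>" 1] \<eta>
    by (subst has_integral_cong[of _ _ "\<lambda>x. x powr (1 - \<eta>)"]) (auto simp: H_def)
  have H1: "(H has_integral 2 / \<eta>) {1..}"
  proof (rule has_integral_spike_finite)
    show "((\<lambda>x. 2 * x powr (- \<eta> - 1)) has_integral 2 / \<eta>) {1..}"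
      using has_integral_mult_right[OF has_integral_powr_to_inf[of "- \<eta> - 1" 1], of 2] \<eta> by simp
    show "finite {1::real}" by simp
  qed (auto simp: H_def)
  have H: "(H has_integral (1 / (2 - \<eta>) + 2 / \<eta>)) {0..}"
  proof -
    have "{0..1} \<union> {1..} = {0::real..}" by auto
    moreover have "{0..1} \<inter> {1..} = {1::real}" by auto
    ultimately show ?thesis using has_integral_Un[OF H01 H1] by simp
  qed
  have cos_bound: "1 - cos x \<le> x\<^sup>2" for x :: real
  proof -
    have "1 - cos x = 2 * (sin (x / 2))\<^sup>2" using cos_double_sin[of "x / 2"] by simp
    moreover have "(sin (x / 2))\<^sup>2 \<le> (x / 2)\<^sup>2"
      using abs_sin_x_le_abs_x[of "x / 2"] by (rule abs_le_square_iff[THEN iffD1])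
    moreover have "2 * (x / 2)\<^sup>2 \<le> x\<^sup>2" by (simp add: power2_eq_square)
    ultimately show ?thesis by linarith
  qed
  have g_nonneg: "0 \<le> g x" for x by (simp add: g_def)
  have g_le: "g x \<le> H x" if "0 \<le> x" for x
  proof (cases "x = 0")
    case False
    then have "0 < x" using that by simp
    show ?thesis
    proof (cases "x \<le> 1")
      case True
      have "g x \<le> x\<^sup>2 * x powr (- \<eta> - 1)" unfolding g_def by (intro mult_right_mono cos_bound) auto
      also have "x\<^sup>2 * x powr (- \<eta> - 1) = x powr 2 * x powr (- \<eta> - 1)" using \<open>0 < x\<close> by (simp add: powr_numeral)
      also have "\<dots> = x powr (2 + (- \<eta> - 1))" by (rule powr_add[symmetric])
      finally show ?thesis using True by (simp add: H_def algebra_simps)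
    next
      case False
      have "1 - cos x \<le> 2" using cos_ge_minus_one[of x] by linarith
      then show ?thesis using False unfolding g_def H_def by (simp add: mult_right_mono)
    qed
  qed (simp add: g_def H_def)
  have "g \<in> borel_measurable borel" unfolding g_def by measurable
  then have g_meas: "g \<in> borel_measurable (lebesgue_on {0..})"
    by (intro measurable_restrict_space1 measurable_completion) simp
  show g_int: "g integrable_on {0..}"
    by (rule measurable_bounded_by_integrable_imp_integrable[OF g_meas has_integral_integrable[OF H]])
      (use g_le g_nonneg in auto)
  show "integral {0..} g \<le> 1 / (2 - \<eta>) + 2 / \<eta>"
    using integral_le[OF g_int has_integral_integrable[OF H]] g_le integral_unique[OF H] by auto
  show "0 < integral {0..} g"
  proof -
    have g12: "g integrable_on {1..2}"
      unfolding g_def by (intro integrable_continuous_interval continuous_intros) auto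
    \<comment> \<open>On [1,2], which lies in [0,pi], the cosine is largest at 1 and the power is
      smallest at 2, so \<open>?m\<close> bounds \<open>g\<close> from below there.\<close>
    let ?m = "(1 - cos 1) * 2 powr (- \<eta> - 1)"
    have "cos (1::real) < cos 0" by (rule cos_monotone_0_pi) (use pi_gt3 in auto)
    then have "0 < ?m" by simp
    also have "?m = integral {1..2::real} (\<lambda>_. ?m)" by simp
    also have "\<dots> \<le> integral {1..2} g"
    proof (rule integral_le[OF _ g12])
      fix x :: real assume x: "x \<in> {1..2}"
      have "cos x \<le> cos 1" using x pi_gt3 by (intro cos_monotone_0_pi_le) auto
      moreover have "2 powr (- \<eta> - 1) \<le> x powr (- \<eta> - 1)"
        using x \<eta> by (intro powr_mono2') auto
      ultimately show "?m \<le> g x" unfolding g_def by (intro mult_mono) auto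
    qed auto
    also have "\<dots> \<le> integral {0..} g"
      by (rule integral_subset_le[OF _ g12 g_int]) (use g_nonneg in auto)
    finally show ?thesis .
  qed
  show "((\<lambda>x. x powr (- \<eta>) * sin x) has_integral (\<eta> * integral {0..} g)) {0..}"
  proof -
    \<comment> \<open>The primitive \<open>1 - cos\<close> of \<open>sin\<close> is chosen because
      it vanishes to second order at 0: the boundary term \<open>k\<close> then tends to 0 at both
      ends although the power blows up at 0.\<close>
    define k where "k x = (1 - cos x) * x powr (- \<eta>)" for x :: real
    define k' where "k' x = x powr (- \<eta>) * sin x - \<eta> * g x" for x :: real
    have k_le: "k x \<le> x powr (2 - \<eta>)" if "0 \<le> x" for x
    proof (cases "x = 0")
      case False
      have "k x \<le> x\<^sup>2 * x powr (- \<eta>)" unfolding k_def by (intro mult_right_mono cos_bound) auto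
      also have "\<dots> = x powr 2 * x powr (- \<eta>)" using that False by (simp add: powr_numeral)
      also have "\<dots> = x powr (2 + (- \<eta>))" by (rule powr_add[symmetric])
      finally show ?thesis by simp
    qed (simp add: k_def)
    have k_nonneg: "0 \<le> k x" for x by (simp add: k_def)
    have deriv: "(k has_real_derivative k' x) (at x)" if "0 < x" for x
    proof -
      have "((\<lambda>x::real. 1 - cos x) has_real_derivative sin x) (at x)"
        by (auto intro!: derivative_eq_intros)
      from DERIV_mult[OF this has_real_derivative_powr[OF that, of "- \<eta>"]]
      show ?thesis unfolding k_def[abs_def] k'_def g_def by (simp add: algebra_simps)
    qed
    have cont0: "(k \<longlongrightarrow> 0) (at_right 0)"
    proof (rule tendsto_sandwich[of "\<lambda>_. 0" k _ "\<lambda>x. x powr (2 - \<eta>)"])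
      show "((\<lambda>x::real. x powr (2 - \<eta>)) \<longlongrightarrow> 0) (at_right 0)"
        using \<eta> by real_asymp
      show "\<forall>\<^sub>F x in at_right 0. k x \<le> x powr (2 - \<eta>)"
        using eventually_at_right_less[of "0::real"] by eventually_elim (use k_le in auto)
    qed (auto simp: k_nonneg)
    have "(k' has_integral k y - k 0) {0..y}" if "0 \<le> y" for y
    proof (rule fundamental_theorem_of_calculus_interior[OF that])
      show "continuous_on {0..y} k"
        unfolding continuous_on_eq_continuous_within
      proof
        fix x assume "x \<in> {0..y}"
        show "continuous (at x within {0..y}) k"
        proof (cases "x = 0")
          case True
          have "(k \<longlongrightarrow> k 0) (at 0 within {0..y})"
            by (rule tendsto_within_subset[of _ _ _ "{0..}"])
              (use cont0 in \<open>auto simp: k_def at_within_Ici_at_right\<close>)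
          then show ?thesis using True by (simp add: continuous_within)
        next
          case False
          with \<open>x \<in> {0..y}\<close> have "isCont k x"
            using DERIV_isCont[OF deriv[of x]] by simp
          then show ?thesis by (rule continuous_at_imp_continuous_at_within)
        qed
      qed
    qed (simp add: deriv flip: has_real_derivative_iff_has_vector_derivative)
    then have int_k': "(k' has_integral k y) {0..y}" if "0 \<le> y" for y
      using that by (simp add: k_def)
    have "(k' has_integral 0) {0..}"
    proof (rule has_integral_half_lineI[OF int_k'])
      show "(k \<longlongrightarrow> 0) at_top"
      proof (rule tendsto_sandwich[of "\<lambda>_. 0" k _ "\<lambda>x. 2 * x powr (- \<eta>)"])
        show "((\<lambda>x::real. 2 * x powr (- \<eta>)) \<longlongrightarrow> 0) at_top" using \<eta> by real_asymp
        have "1 - cos x \<le> 2" for x :: real using cos_ge_minus_one[of x] by linarith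
        then show "\<forall>\<^sub>F x in at_top. k x \<le> 2 * x powr (- \<eta>)"
          by (intro always_eventually) (auto simp: k_def mult_right_mono)
      qed (auto simp: k_nonneg)
    qed
    from has_integral_add[OF this has_integral_mult_right[OF integrable_integral[OF g_int], of \<eta>]]
    show ?thesis by (simp add: k'_def)
  qed
qed

text \<open>Multiplying the bound on the integral by \<eta> cancels the pole 2 / \<eta>, so the
  result depends on \<open>d\<close> alone. This uniformity matters because the jump estimate
  evaluates the constant at exponents that vary with the index.\<close>

lemma stable_const_ge:
  assumes "0 < \<eta>" "\<eta> \<le> d" "d < 2"
  shows "1 / (2 / (2 - d) + 2) \<le> stable_const \<eta>"
proof -
  define J where "J = integral {0..} (\<lambda>x::real. (1 - cos x) * x powr (- \<eta> - 1))"
  have \<eta>: "0 < \<eta>" "\<eta> < 2" using assms by auto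
  have J: "0 < J" "J \<le> 1 / (2 - \<eta>) + 2 / \<eta>"
    unfolding J_def by (rule stable_const_integral[OF \<eta>])+
  have "\<eta> * J \<le> \<eta> * (1 / (2 - \<eta>) + 2 / \<eta>)" using J \<eta> by (intro mult_left_mono) auto
  also have "\<dots> = \<eta> / (2 - \<eta>) + 2" using \<eta> by (simp add: field_simps)
  also have "\<eta> / (2 - \<eta>) \<le> 2 / (2 - d)" using assms by (intro frac_le) auto
  finally have "\<eta> * J \<le> 2 / (2 - d) + 2" by simp
  moreover have "stable_const \<eta> = inverse (\<eta> * J)"
    unfolding stable_const_def J_def integral_unique[OF integral_sin_powr[OF \<eta>]] ..
  moreover have "0 < \<eta> * J" using J \<eta> by simp
  ultimately show ?thesis by (simp add: inverse_eq_divide frac_le)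
qed

subsection \<open>Coordinatewise measure-preserving maps of sequence spaces\<close>

lemma measurable_PiM_UNIV:
  assumes "\<And>i. f i \<in> measurable N (M i)"
  shows "(\<lambda>\<omega> i. f i \<omega>) \<in> measurable N (PiM UNIV M)"
  by (rule measurable_PiM_single') (auto simp: PiE_iff intro: assms measurable_space[OF assms])

text \<open>A set depending on coordinate \<open>k\<close> only is not affected by
  \<open>T i\<close> for i > k. The sets with the claimed limit are closed under complements and
  countable unions, hence comprise the whole product \<sigma>-algebra.\<close>

lemma single_coordinate_map_asymptotically_invariant:
  fixes P :: "(nat \<Rightarrow> 'b) measure" and T :: "nat \<Rightarrow> (nat \<Rightarrow> 'b) \<Rightarrow> nat \<Rightarrow> 'b"
  assumes "prob_space P" and sets_P: "sets P = sets (PiM UNIV N)"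
    and T[measurable]: "\<And>i. T i \<in> measurable P P"
    and inv: "\<And>i. distr P P (T i) = P"
    and coord: "\<And>i j x. j \<noteq> i \<Longrightarrow> T i x j = x j"
    and A: "A \<in> sets P"
  shows "(\<lambda>i. measure P {x \<in> space P. (x \<in> A) \<noteq> (T i x \<in> A)}) \<longlonglongrightarrow> 0"
proof -
  interpret prob_space P by fact
  have space_P: "space P = (\<Pi>\<^sub>E i\<in>UNIV. space (N i))"
    using sets_eq_imp_space_eq[OF sets_P] by (simp add: space_PiM)
  have T_space: "T i x \<in> space P" if "x \<in> space P" for i x
    using measurable_space[OF T that] .
  let ?D = "\<lambda>A i. {x \<in> space P. (x \<in> A) \<noteq> (T i x \<in> A)}"
  have "A \<in> sigma_sets (space P) {{f\<in>space P. f i \<in> B} | i B. i \<in> UNIV \<and> B \<in> sets (N i)}"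
    using A unfolding sets_P sets_PiM_single space_P by simp
  then have "A \<in> sets P \<and> (\<lambda>i. prob (?D A i)) \<longlonglongrightarrow> 0"
  proof induction
    case (Basic a)
    then obtain k B where B: "B \<in> sets (N k)" "a = {f\<in>space P. f k \<in> B}" by auto
    have "a \<in> sets P"
      using B unfolding sets_P sets_PiM_single space_P by (intro sigma_sets.Basic) auto
    moreover have "eventually (\<lambda>i. prob (?D a i) = 0) sequentially"
      using eventually_gt_at_top[of k]
    proof eventually_elim
      case (elim i)
      then have "?D a i = {}" using T_space coord[of k i] B by auto
      then show ?case by (simp only: measure_empty)
    qed
    ultimately show ?case by (simp add: tendsto_eventually)
  next
    case Empty
    show ?case by simp
  next
    case (Compl a)
    have "?D (space P - a) i = ?D a i" for i using T_space by auto
    with Compl show ?case by auto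
  next
    case (Union a)
    then have [measurable]: "a k \<in> sets P" for k by auto
    \<comment> \<open>\<open>R n\<close> is what the first \<open>n\<close> sets miss of the union.
      A point whose membership in the union is changed by \<open>T i\<close> either changes
      membership in one of these \<open>n\<close> sets, or it or its image lies in
      \<open>R n\<close>; since \<open>T i\<close> preserves the measure, each of the three
      contributions is below e / 3.\<close>
    define R where "R n = (\<Union>k. a k) - (\<Union>k<n. a k)" for n
    have [measurable]: "R n \<in> sets P" for n unfolding R_def by measurable
    have "(\<lambda>n. prob (R n)) \<longlonglongrightarrow> prob (\<Inter>n. R n)"
      by (intro finite_Lim_measure_decseq) (auto simp: decseq_def R_def)
    moreover have "(\<Inter>n. R n) = {}" by (auto simp: R_def)
    ultimately have R0: "(\<lambda>n. prob (R n)) \<longlonglongrightarrow> 0" by simp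
    have "(\<lambda>i. prob (?D (\<Union>k. a k) i)) \<longlonglongrightarrow> 0"
    proof (rule LIMSEQ_I)
      fix e :: real assume "0 < e"
      then have "\<forall>\<^sub>F n in sequentially. prob (R n) < e / 3"
        using order_tendstoD(2)[OF R0, of "e/3"] by simp
      then obtain n where n: "prob (R n) < e / 3"
        by (auto simp: eventually_sequentially)
      have "(\<lambda>i. \<Sum>k<n. prob (?D (a k) i)) \<longlonglongrightarrow> 0"
        by (rule tendsto_null_sum) (use Union in auto)
      then have "\<forall>\<^sub>F i in sequentially. (\<Sum>k<n. prob (?D (a k) i)) < e / 3"
        using order_tendstoD(2)[of _ 0 _ "e/3"] \<open>0 < e\<close> by simp
      then obtain m where m: "(\<Sum>k<n. prob (?D (a k) i)) < e / 3" if "i \<ge> m" for i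
        by (auto simp: eventually_sequentially)
      show "\<exists>no. \<forall>i\<ge>no. norm (prob (?D (\<Union>k. a k) i) - 0) < e"
      proof (intro exI[of _ m] allI impI)
        fix i assume "m \<le> i"
        have TR: "T i -` R n \<inter> space P \<in> sets P" by (rule measurable_sets[OF T]) simp
        have D[measurable]: "?D (a k) i \<in> sets P" for k by measurable
        have "prob (T i -` R n \<inter> space P) = prob (R n)"
          using measure_distr[OF T, of "R n" i] inv[of i] by simp
        moreover have "prob (?D (\<Union>k. a k) i) \<le>
            prob ((\<Union>k<n. ?D (a k) i) \<union> R n \<union> (T i -` R n \<inter> space P))"
        proof (rule finite_measure_mono)
          show "?D (\<Union>k. a k) i \<subseteq> (\<Union>k<n. ?D (a k) i) \<union> R n \<union> (T i -` R n \<inter> space P)"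
            unfolding R_def by auto
          show "(\<Union>k<n. ?D (a k) i) \<union> R n \<union> (T i -` R n \<inter> space P) \<in> events"
            using TR D by auto
        qed
        moreover have "\<dots> \<le> prob ((\<Union>k<n. ?D (a k) i) \<union> R n) + prob (T i -` R n \<inter> space P)"
          by (rule measure_Un_le) (use TR D in auto)
        moreover have "prob ((\<Union>k<n. ?D (a k) i) \<union> R n) \<le> prob (\<Union>k<n. ?D (a k) i) + prob (R n)"
          by (rule measure_Un_le) (use D in auto)
        moreover have "prob (\<Union>k<n. ?D (a k) i) \<le> (\<Sum>k<n. prob (?D (a k) i))"
          by (rule finite_measure_subadditive_finite) (use D in auto)
        ultimately have "prob (?D (\<Union>k. a k) i) < e"
          using m[OF \<open>m \<le> i\<close>] n by linarith
        then show "norm (prob (?D (\<Union>k. a k) i) - 0) < e" by simp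
      qed
    qed
    then show ?case by simp
  qed
  then show ?thesis by simp
qed

text \<open>If \<open>T i\<close> moves all of \<open>A\<close> off \<open>A\<close>, then
  \<open>A\<close> is contained in the set where \<open>T i\<close> changes membership, whose
  measure tends to 0. Infinitely many such \<open>i\<close> therefore suffice.\<close>

lemma null_if_frequently_displaced:
  fixes P :: "(nat \<Rightarrow> 'b) measure" and T :: "nat \<Rightarrow> (nat \<Rightarrow> 'b) \<Rightarrow> nat \<Rightarrow> 'b"
  assumes "prob_space P" and sets_P: "sets P = sets (PiM UNIV N)"
    and T: "\<And>i. T i \<in> measurable P P"
    and inv: "\<And>i. distr P P (T i) = P"
    and coord: "\<And>i j x. j \<noteq> i \<Longrightarrow> T i x j = x j"
    and A: "A \<in> sets P"
    and displaced: "\<exists>\<^sub>F i in sequentially. \<forall>x\<in>A. T i x \<notin> A"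
  shows "measure P A = 0"
proof (rule ccontr)
  assume "measure P A \<noteq> 0"
  then have pos: "measure P A > 0" by (simp add: zero_less_measure_iff)
  interpret prob_space P by fact
  have "\<forall>\<^sub>F i in sequentially. measure P {x \<in> space P. (x \<in> A) \<noteq> (T i x \<in> A)} < measure P A"
    using order_tendstoD(2)[OF single_coordinate_map_asymptotically_invariant[OF assms(1-6)] pos] .
  with displaced have "\<exists>\<^sub>F i in sequentially. (\<forall>x\<in>A. T i x \<notin> A) \<and>
      measure P {x \<in> space P. (x \<in> A) \<noteq> (T i x \<in> A)} < measure P A"
    by (rule frequently_eventually_frequently)
  then have "\<exists>\<^sub>F i::nat in sequentially. False"
  proof (rule frequently_elim1, elim conjE)
    fix i assume less: "measure P {x \<in> space P. (x \<in> A) \<noteq> (T i x \<in> A)} < measure P A"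
      and disj: "\<forall>x\<in>A. T i x \<notin> A"
    have "measure P A \<le> measure P {x \<in> space P. (x \<in> A) \<noteq> (T i x \<in> A)}"
    proof (rule finite_measure_mono)
      show "A \<subseteq> {x \<in> space P. (x \<in> A) \<noteq> (T i x \<in> A)}"
        using disj sets.sets_into_space[OF A] by auto
      have [measurable]: "T i \<in> measurable P P" by (rule T)
      note A[measurable]
      show "{x \<in> space P. (x \<in> A) \<noteq> (T i x \<in> A)} \<in> events" by measurable
    qed
    with less show False by simp
  qed
  then show False by simp
qed

subsection \<open>Summation by parts\<close>

lemma sum_mult_by_parts:
  fixes x b :: "nat \<Rightarrow> real"
  shows "(\<Sum>i<n. x i * b i) = (\<Sum>i<n. x i) * b n + (\<Sum>i<n. (\<Sum>j<Suc i. x j) * (b i - b (Suc i)))"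
  by (induction n) (simp_all add: algebra_simps)

lemma powr_increment_le:
  fixes \<beta> :: real
  assumes "0 < \<beta>" "\<beta> \<le> 1" "0 < x"
  shows "(x + 1) powr \<beta> - x powr \<beta> \<le> \<beta> * x powr (\<beta> - 1)"
proof -
  have "\<exists>z. x < z \<and> z < x + 1 \<and> (x + 1) powr \<beta> - x powr \<beta> = (x + 1 - x) * (\<beta> * z powr (\<beta> - 1))"
    by (rule MVT2) (use assms in \<open>auto intro!: derivative_eq_intros\<close>)
  then obtain z where z: "x < z" "(x + 1) powr \<beta> - x powr \<beta> = \<beta> * z powr (\<beta> - 1)" by auto
  have "z powr (\<beta> - 1) \<le> x powr (\<beta> - 1)"
    using z assms by (intro powr_mono2') auto
  then show ?thesis using z assms by simp
qed

text \<open>Summation by parts moves the difference from \<open>b\<close> to the power, whose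
  increments are at most i^(\<beta> - 1). What remains is dominated by a multiple of i^(\<beta> - 1
  - p), summable because \<beta> < p.\<close>

lemma summable_powr_mult_decrements:
  fixes b :: "nat \<Rightarrow> real"
  assumes \<beta>: "0 < \<beta>" "\<beta> \<le> 1" "\<beta> < p"
    and nonneg: "\<And>i. 0 \<le> b i" and decr: "\<And>i. b (Suc i) \<le> b i"
    and bound: "\<And>i. b i \<le> C * real (Suc i) powr (- p)"
  shows "summable (\<lambda>i. real (Suc i) powr \<beta> * (b i - b (Suc i)))"
proof -
  have C: "0 \<le> C" using order_trans[OF nonneg[of 0] bound[of 0]] by simp
  \<comment> \<open>The negative boundary term is kept so that the induction closes with the
    increment of the power alone; it is dropped only in the final bound.\<close>
  have parts: "(\<Sum>i<n. real (Suc i) powr \<beta> * (b i - b (Suc i)))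
      \<le> (\<Sum>i<n. C * real (Suc i) powr (\<beta> - 1 - p)) + b 0 - real (Suc n) powr \<beta> * b n" for n
  proof (induction n)
    case (Suc n)
    have "(real (Suc n) + 1) powr \<beta> - real (Suc n) powr \<beta> \<le> \<beta> * real (Suc n) powr (\<beta> - 1)"
      by (rule powr_increment_le) (use \<beta> in auto)
    also have "\<dots> \<le> real (Suc n) powr (\<beta> - 1)" using \<beta> by (simp add: mult_left_le_one_le)
    finally have 1: "real (Suc (Suc n)) powr \<beta> - real (Suc n) powr \<beta> \<le> real (Suc n) powr (\<beta> - 1)"
      by (simp add: algebra_simps)
    have "(real (Suc (Suc n)) powr \<beta> - real (Suc n) powr \<beta>) * b (Suc n)
        \<le> real (Suc n) powr (\<beta> - 1) * (C * real (Suc n) powr (- p))"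
    proof (rule mult_mono[OF 1 order_trans[OF decr bound]])
    qed (use nonneg in auto)
    also have "\<dots> = C * real (Suc n) powr (\<beta> - 1 - p)"
      using powr_add[of "real (Suc n)" "\<beta> - 1" "- p"] by (simp add: mult_ac)
    finally show ?case using Suc by (simp add: algebra_simps)
  qed simp
  have "summable (\<lambda>i. C * real (Suc i) powr (\<beta> - 1 - p))"
    using \<beta> by (intro summable_mult) (subst summable_Suc_iff[of "\<lambda>i. real i powr (\<beta> - 1 - p)"], simp add: summable_real_powr_iff)
  note S = this
  show ?thesis
  proof (rule summableI_nonneg_bounded)
    show "(\<Sum>i<n. real (Suc i) powr \<beta> * (b i - b (Suc i)))
        \<le> (\<Sum>i. C * real (Suc i) powr (\<beta> - 1 - p)) + b 0" for n
    proof -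
      have "(\<Sum>i<n. C * real (Suc i) powr (\<beta> - 1 - p))
          \<le> (\<Sum>i. C * real (Suc i) powr (\<beta> - 1 - p))"
        using C by (intro sum_le_suminf[OF S]) auto
      moreover have "0 \<le> real (Suc n) powr \<beta> * b n" using nonneg by simp
      ultimately show ?thesis using parts[of n] by linarith
    qed
  qed (use decr in auto)
qed

text \<open>A Dirichlet test in which the partial sums may grow: the decay n^(-p) of
  \<open>b\<close> beats their growth n^\<beta>, both in the boundary term and in the series of
  decrements.\<close>

lemma summable_mult_by_parts:
  fixes x b :: "nat \<Rightarrow> real"
  assumes \<beta>: "0 < \<beta>" "\<beta> \<le> 1" "\<beta> < p"
    and nonneg: "\<And>i. 0 \<le> b i" and decr: "\<And>i. b (Suc i) \<le> b i"
    and bound: "\<And>i. b i \<le> C * real (Suc i) powr (- p)"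
    and partial_sums: "eventually (\<lambda>n. \<bar>\<Sum>i<n. x i\<bar> \<le> real n powr \<beta>) sequentially"
  shows "summable (\<lambda>i. x i * b i)"
proof -
  have "summable (\<lambda>i. (\<Sum>j<Suc i. x j) * (b i - b (Suc i)))"
  proof (rule summable_comparison_test_ev)
    show "summable (\<lambda>i. real (Suc i) powr \<beta> * (b i - b (Suc i)))"
      by (rule summable_powr_mult_decrements[OF \<beta> nonneg decr bound])
    show "\<forall>\<^sub>F i in sequentially. norm ((\<Sum>j<Suc i. x j) * (b i - b (Suc i)))
        \<le> real (Suc i) powr \<beta> * (b i - b (Suc i))"
      using eventually_compose_filterlim[OF partial_sums filterlim_Suc]
    proof eventually_elim
      case (elim i)
      have "\<bar>\<Sum>j<Suc i. x j\<bar> * \<bar>b i - b (Suc i)\<bar> \<le> real (Suc i) powr \<beta> * \<bar>b i - b (Suc i)\<bar>"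
        using elim by (rule mult_right_mono) simp
      then show ?case using decr[of i] unfolding real_norm_def abs_mult by linarith
    qed
  qed
  then have conv: "convergent (\<lambda>n. \<Sum>i<n. (\<Sum>j<Suc i. x j) * (b i - b (Suc i)))"
    by (simp add: summable_iff_convergent)
  have "(\<lambda>n. (\<Sum>i<n. x i) * b n) \<longlonglongrightarrow> 0"
  proof (rule Lim_null_comparison)
    show "\<forall>\<^sub>F n in sequentially. norm ((\<Sum>i<n. x i) * b n) \<le> C * real (Suc n) powr (\<beta> - p)"
      using partial_sums
    proof eventually_elim
      case (elim n)
      have "\<bar>\<Sum>i<n. x i\<bar> \<le> real (Suc n) powr \<beta>"
        using elim \<beta> by (rule_tac order_trans) (auto intro!: powr_mono2)
      then have "\<bar>\<Sum>i<n. x i\<bar> * b n \<le> real (Suc n) powr \<beta> * (C * real (Suc n) powr (- p))"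
        by (rule mult_mono[OF _ bound]) (use nonneg in auto)
      also have "\<dots> = C * real (Suc n) powr (\<beta> - p)"
        by (simp add: powr_diff powr_minus field_simps)
      finally show ?case using nonneg[of n] by (simp add: abs_mult)
    qed
    have "((\<lambda>n. real n powr (\<beta> - p)) \<longlonglongrightarrow> 0)"
      using \<beta> by (intro tendsto_neg_powr filterlim_real_sequentially) auto
    then have "(\<lambda>n. real (Suc n) powr (\<beta> - p)) \<longlonglongrightarrow> 0"
      by (rule LIMSEQ_Suc)
    then show "(\<lambda>n. C * real (Suc n) powr (\<beta> - p)) \<longlonglongrightarrow> 0" by (rule tendsto_mult_right_zero)
  qed
  then have "convergent (\<lambda>n. (\<Sum>i<n. x i) * b n + (\<Sum>i<n. (\<Sum>j<Suc i. x j) * (b i - b (Suc i))))"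
    using conv by (intro convergent_add) (auto simp: convergent_def)
  then show ?thesis
    unfolding summable_iff_convergent by (subst sum_mult_by_parts)
qed

subsection \<open>Random signs\<close>

text \<open>Isolates the signs, so that the results below concern series with deterministic
  coefficients. They are applied later with the arrival times and the marks frozen.\<close>

locale rademacher_sequence = prob_space M for M :: "'a measure" +
  fixes \<gamma> :: "nat \<Rightarrow> 'a \<Rightarrow> real"
  assumes sign_indep: "indep_vars (\<lambda>_. borel) \<gamma> UNIV"
    and sign_pos: "\<And>i. prob {\<omega> \<in> space M. \<gamma> i \<omega> = 1} = 1 / 2"
    and sign_neg: "\<And>i. prob {\<omega> \<in> space M. \<gamma> i \<omega> = - 1} = 1 / 2"
begin

lemma sign_measurable[measurable]: "\<gamma> i \<in> borel_measurable M"
  using sign_indep by (auto simp: indep_vars_def)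

lemma AE_sign: "AE \<omega> in M. \<gamma> i \<omega> = 1 \<or> \<gamma> i \<omega> = - 1"
proof -
  have "prob ({\<omega> \<in> space M. \<gamma> i \<omega> = 1} \<union> {\<omega> \<in> space M. \<gamma> i \<omega> = - 1}) = 1 / 2 + 1 / 2"
    unfolding sign_pos[of i, symmetric] by (subst finite_measure_Union) (auto simp: sign_pos sign_neg)
  then have "prob {\<omega> \<in> space M. \<gamma> i \<omega> = 1 \<or> \<gamma> i \<omega> = - 1} = 1"
    by (simp add: Un_def Collect_disj_eq[symmetric] conj_disj_distribL)
  then show ?thesis by (simp add: prob_Collect_eq_1)
qed

lemma prob_sign:
  assumes [measurable]: "B \<in> sets borel"
  shows "prob {\<omega> \<in> space M. \<gamma> i \<omega> \<in> B} = (indicator B 1 + indicator B (- 1)) / 2"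
proof -
  have "prob {\<omega> \<in> space M. \<gamma> i \<omega> \<in> B} =
      prob ({\<omega> \<in> space M. \<gamma> i \<omega> = 1 \<and> 1 \<in> B} \<union> {\<omega> \<in> space M. \<gamma> i \<omega> = - 1 \<and> - 1 \<in> B})"
    by (rule finite_measure_eq_AE) (use AE_sign[of i] in auto)
  also have "\<dots> = prob {\<omega> \<in> space M. \<gamma> i \<omega> = 1 \<and> 1 \<in> B} + prob {\<omega> \<in> space M. \<gamma> i \<omega> = - 1 \<and> - 1 \<in> B}"
    by (rule finite_measure_Union) auto
  also have "\<dots> = (indicator B 1 + indicator B (- 1)) / 2"
    by (cases "1 \<in> B"; cases "- 1 \<in> B") (simp_all add: sign_pos sign_neg)
  finally show ?thesis .
qed

lemma distr_minus_sign: "distr M borel (\<lambda>\<omega>. - \<gamma> i \<omega>) = distr M borel (\<gamma> i)"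
proof (rule measure_eqI)
  fix B assume "B \<in> sets (distr M borel (\<lambda>\<omega>. - \<gamma> i \<omega>))"
  then have B[measurable]: "B \<in> sets borel" by simp
  have uB: "uminus -` B \<in> sets borel" 
    using measurable_sets[OF borel_measurable_uminus[OF measurable_ident_sets[OF refl]] B] by simp
  have "prob {\<omega> \<in> space M. - \<gamma> i \<omega> \<in> B} = prob {\<omega> \<in> space M. \<gamma> i \<omega> \<in> B}"
    using prob_sign[OF B, of i] prob_sign[OF uB, of i] by (simp add: indicator_def)
  then show "emeasure (distr M borel (\<lambda>\<omega>. - \<gamma> i \<omega>)) B = emeasure (distr M borel (\<gamma> i)) B"
    by (simp add: emeasure_distr emeasure_eq_measure vimage_def Int_def conj_commute)
qed simp

lemma expectation_sign: "expectation (\<gamma> i) = 0"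
proof -
  have "expectation (\<gamma> i) = expectation (\<lambda>\<omega>. indicator {\<omega> \<in> space M. \<gamma> i \<omega> = 1} \<omega> -
      indicator {\<omega> \<in> space M. \<gamma> i \<omega> = - 1} \<omega>)"
  proof (rule integral_cong_AE)
    show "AE \<omega> in M. \<gamma> i \<omega> = indicator {\<omega> \<in> space M. \<gamma> i \<omega> = 1} \<omega> -
        indicator {\<omega> \<in> space M. \<gamma> i \<omega> = - 1} \<omega>"
      using AE_sign[of i] AE_space by eventually_elim auto
  qed measurable
  also have "\<dots> = 0"
    by (subst Bochner_Integration.integral_diff) (auto simp: sign_pos sign_neg integrable_indicator_iff less_top[symmetric])
  finally show ?thesis .
qed

text \<open>By independence both laws are products, and symmetry makes the factors agree. This
  supplies the measure preservation required of the displacing maps.\<close>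

lemma distr_flip_sign:
  "distr M (PiM UNIV (\<lambda>_. borel)) (\<lambda>\<omega> j. if j = i then - \<gamma> j \<omega> else \<gamma> j \<omega>) =
   distr M (PiM UNIV (\<lambda>_. borel)) (\<lambda>\<omega> j. \<gamma> j \<omega>)"
proof -
  define \<gamma>' where "\<gamma>' j \<omega> = (if j = i then - \<gamma> j \<omega> else \<gamma> j \<omega>)" for j \<omega>
  have "indep_vars (\<lambda>_. borel) (\<lambda>j \<omega>. (\<lambda>x. if j = i then - x else x) (\<gamma> j \<omega>)) UNIV"
    by (rule indep_vars_compose2[OF sign_indep]) simp
  then have ind': "indep_vars (\<lambda>_. borel) \<gamma>' UNIV" unfolding \<gamma>'_def .
  have [measurable]: "\<gamma>' j \<in> borel_measurable M" for j unfolding \<gamma>'_def by simp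
  have "distr M borel (\<gamma>' j) = distr M borel (\<gamma> j)" for j
    using distr_minus_sign[of i] by (cases "j = i") (simp_all add: \<gamma>'_def[abs_def])
  moreover have "distr M (PiM UNIV (\<lambda>_. borel)) (\<lambda>\<omega> j. \<gamma>' j \<omega>) = PiM UNIV (\<lambda>j. distr M borel (\<gamma>' j))"
    using indep_vars_iff_distr_eq_PiM[of UNIV \<gamma>' "\<lambda>_. borel"] ind' by (simp add: restrict_UNIV)
  moreover have "distr M (PiM UNIV (\<lambda>_. borel)) (\<lambda>\<omega> j. \<gamma> j \<omega>) = PiM UNIV (\<lambda>j. distr M borel (\<gamma> j))"
    using indep_vars_iff_distr_eq_PiM[of UNIV \<gamma> "\<lambda>_. borel"] sign_indep by (simp add: restrict_UNIV)
  ultimately show ?thesis unfolding \<gamma>'_def by simp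
qed

lemma prob_weighted_sum_ge:
  fixes w :: "nat \<Rightarrow> real"
  assumes w: "\<And>i. \<bar>w i\<bar> \<le> 1" and \<epsilon>: "0 \<le> \<epsilon>" and n: "0 < n"
  shows "prob {\<omega> \<in> space M. \<epsilon> \<le> \<bar>\<Sum>i<n. \<gamma> i \<omega> * w i\<bar>} \<le> 2 * exp (- \<epsilon>\<^sup>2 / (2 * real n))"
proof -
  have ind: "indep_vars (\<lambda>_. borel) (\<lambda>i \<omega>. (\<lambda>x. x * w i) (\<gamma> i \<omega>)) UNIV"
    by (rule indep_vars_compose2[OF sign_indep]) simp
  interpret H: Hoeffding_ineq M "{..<n}" "\<lambda>i \<omega>. \<gamma> i \<omega> * w i" "\<lambda>_. - 1" "\<lambda>_. 1" 0
  proof unfold_locales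
    show "indep_vars (\<lambda>_. borel) (\<lambda>i \<omega>. \<gamma> i \<omega> * w i) {..<n}"
      using ind by (rule indep_vars_subset) simp
    show "AE \<omega> in M. \<gamma> i \<omega> * w i \<in> {- 1..1}" for i
      using AE_sign[of i] by eventually_elim (use w[of i] in auto)
  qed (simp_all add: expectation_sign)
  \<comment> \<open>Each summand ranges over an interval of length 2, so the exponent -2
    \<epsilon>^2 / (4 n) of Hoeffding's inequality reduces to the stated one.\<close>
  have "(\<Sum>i<n. (1 - (- 1::real))\<^sup>2) = 4 * real n" by simp
  then show ?thesis using H.Hoeffding_ineq_abs_ge[OF \<epsilon>] n by simp
qed

text \<open>Hoeffding's inequality at the level n^\<beta> has exponent -n^(2 \<beta> - 1) / 2. Since
  \<beta> > 1/2 these bounds are summable, and the Borel-Cantelli lemma applies.\<close>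

lemma AE_weighted_sum_le:
  fixes w :: "nat \<Rightarrow> real"
  assumes w: "\<And>i. \<bar>w i\<bar> \<le> 1" and \<beta>: "1 / 2 < \<beta>"
  shows "AE \<omega> in M. \<forall>\<^sub>F n in sequentially. \<bar>\<Sum>i<n. \<gamma> i \<omega> * w i\<bar> \<le> real n powr \<beta>"
proof -
  let ?A = "\<lambda>n. {\<omega> \<in> space M. real n powr \<beta> \<le> \<bar>\<Sum>i<n. \<gamma> i \<omega> * w i\<bar>}"
  define q where "q = 2 * \<beta> - 1"
  have q: "0 < q" using \<beta> by (simp add: q_def)
  have bound: "prob (?A n) \<le> 2 * exp (- (real n powr q / 2))" if "0 < n" for n
  proof -
    have "(real n powr \<beta>)\<^sup>2 = real n powr (2 * \<beta>)"
      by (simp add: power2_eq_square powr_add[symmetric])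
    also have "\<dots> = real n powr q * real n"
      using that by (simp add: q_def powr_diff)
    finally have "- (real n powr \<beta>)\<^sup>2 / (2 * real n) = - (real n powr q / 2)" using that by simp
    moreover have "prob (?A n) \<le> 2 * exp (- (real n powr \<beta>)\<^sup>2 / (2 * real n))"
      by (rule prob_weighted_sum_ge[OF w _ that]) simp
    ultimately show ?thesis by metis
  qed
  have "summable (\<lambda>n. prob (?A n))"
  proof (rule summable_comparison_test_ev)
    show "summable (\<lambda>n. real n powr (- 2))" by (simp add: summable_real_powr_iff)
    have "\<forall>\<^sub>F n in sequentially. 2 * exp (- (real n powr q / 2)) \<le> real n powr (- 2)"
      using q by real_asymp
    then show "\<forall>\<^sub>F n in sequentially. norm (prob (?A n)) \<le> real n powr (- 2)"
      using eventually_gt_at_top[of 0]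
    proof eventually_elim
      case (elim n)
      then show ?case using bound[of n] by simp
    qed
  qed
  then have "AE \<omega> in M. \<forall>\<^sub>F n in sequentially. \<omega> \<in> space M - ?A n"
    by (intro borel_cantelli_AE1) (auto simp: emeasure_eq_measure)
  then show ?thesis
  proof eventually_elim
    case (elim \<omega>)
    then show ?case by eventually_elim auto
  qed
qed

text \<open>With \<open>a n\<close> and \<open>b\<close> as the coefficients at the times t + r n
  and t, flipping a sign \<open>i\<close> with \<open>b i = 0\<close> leaves the second series alone
  and moves \<open>F i\<close> by 2 |D i * a i i| > 2 * \<epsilon> i. Hence \<open>F i\<close>
  cannot be within \<epsilon> i of 0 both before and after the flip.\<close>

lemma AE_not_eventually_small:
  fixes a :: "nat \<Rightarrow> nat \<Rightarrow> real" and b D \<epsilon> :: "nat \<Rightarrow> real" and E :: real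
  defines "F \<equiv> \<lambda>n \<sigma>. D n * (\<Sum>i. \<sigma> i * a n i) - E * (\<Sum>i. \<sigma> i * b i)"
  assumes summ: "\<And>n. AE \<omega> in M. summable (\<lambda>i. \<gamma> i \<omega> * a n i)"
    and freq: "\<exists>\<^sub>F i in sequentially. b i = 0 \<and> \<epsilon> i < \<bar>D i * a i i\<bar>"
  shows "AE \<omega> in M. \<not> (\<forall>\<^sub>F n in sequentially. \<bar>F n (\<lambda>i. \<gamma> i \<omega>)\<bar> \<le> \<epsilon> n)"
proof -
  define S where "S = PiM UNIV (\<lambda>_::nat. borel :: real measure)"
  define P where "P = distr M S (\<lambda>\<omega> i. \<gamma> i \<omega>)"
  define flip where "flip i \<sigma> j = (if j = i then - \<sigma> j else \<sigma> j)" for i j :: nat and \<sigma> :: "nat \<Rightarrow> real"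
  have \<gamma>: "(\<lambda>\<omega> i. \<gamma> i \<omega>) \<in> measurable M S"
    unfolding S_def by (rule measurable_PiM_UNIV) measurable
  have [measurable_cong]: "sets P = sets S" by (simp add: P_def)
  interpret P: prob_space P unfolding P_def using \<gamma> by (rule prob_space_distr)
  have coord[measurable]: "(\<lambda>\<sigma>. \<sigma> i) \<in> borel_measurable P" for i
    unfolding measurable_cong_sets[OF \<open>sets P = sets S\<close> refl] S_def
    by (rule measurable_component_singleton) simp
  have flip: "flip i \<in> measurable P P" for i
    unfolding measurable_cong_sets[OF refl \<open>sets P = sets S\<close>] unfolding S_def flip_def[abs_def]
    by (rule measurable_PiM_UNIV) simp
  have inv: "distr P P (flip i) = P" for i
  proof -
    have "distr P P (flip i) = distr P S (flip i)"
      by (rule distr_cong) (simp_all add: P_def)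
    also have "\<dots> = distr M S (flip i \<circ> (\<lambda>\<omega> i. \<gamma> i \<omega>))"
      unfolding P_def by (rule distr_distr[OF _ \<gamma>]) (use flip[of i] in \<open>simp add: P_def cong: measurable_cong_sets\<close>)
    also have "\<dots> = P"
      using distr_flip_sign[of i] by (simp add: P_def S_def comp_def flip_def[abs_def])
    finally show ?thesis .
  qed
  have F[measurable]: "F n \<in> borel_measurable P" for n
    unfolding F_def by measurable
  have [measurable]: "Measurable.pred P (\<lambda>\<sigma>. summable (\<lambda>i. \<sigma> i * a n i))" for n
    unfolding summable_iff_convergent Cauchy_convergent_iff[symmetric] pred_def
    by (rule sets_Collect_Cauchy) measurable
  \<comment> \<open>Convergence and unit modulus hold only almost surely, but the displacement must
    hold at every point of the set. They are therefore built into \<open>A m\<close> and discharged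
    at the end.\<close>
  define A where "A m = {\<sigma> \<in> space P. (\<forall>n\<ge>m. \<bar>F n \<sigma>\<bar> \<le> \<epsilon> n) \<and>
      (\<forall>n. summable (\<lambda>i. \<sigma> i * a n i)) \<and> (\<forall>i. \<bar>\<sigma> i\<bar> = 1)}" for m
  have A[measurable]: "A m \<in> sets P" for m
    unfolding A_def by measurable
  have disj: "flip k \<sigma> \<notin> A m" if "b k = 0" "\<epsilon> k < \<bar>D k * a k k\<bar>" "m \<le> k" "\<sigma> \<in> A m" for k m \<sigma>
  proof
    assume "flip k \<sigma> \<in> A m"
    have \<sigma>: "\<bar>F k \<sigma>\<bar> \<le> \<epsilon> k" "\<bar>F k (flip k \<sigma>)\<bar> \<le> \<epsilon> k" "\<bar>\<sigma> k\<bar> = 1"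
      "summable (\<lambda>i. \<sigma> i * a k i)"
      using \<open>\<sigma> \<in> A m\<close> \<open>flip k \<sigma> \<in> A m\<close> \<open>m \<le> k\<close> by (auto simp: A_def)
    have "flip k \<sigma> i * a k i = \<sigma> i * a k i - (if i = k then 2 * \<sigma> k * a k k else 0)" for i
      by (simp add: flip_def)
    moreover have "(\<lambda>i. \<sigma> i * a k i - (if i = k then 2 * \<sigma> k * a k k else 0)) sums
        ((\<Sum>i. \<sigma> i * a k i) - 2 * \<sigma> k * a k k)"
      by (intro sums_diff summable_sums \<sigma> sums_single)
    ultimately have a: "(\<Sum>i. flip k \<sigma> i * a k i) = (\<Sum>i. \<sigma> i * a k i) - 2 * \<sigma> k * a k k"
      by (simp add: sums_iff)
    have b: "(\<lambda>i. flip k \<sigma> i * b i) = (\<lambda>i. \<sigma> i * b i)"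
      using \<open>b k = 0\<close> by (auto simp: flip_def)
    have "F k \<sigma> - F k (flip k \<sigma>) = 2 * \<sigma> k * (D k * a k k)"
      unfolding F_def a b by (simp add: algebra_simps)
    then have "\<bar>F k \<sigma> - F k (flip k \<sigma>)\<bar> = 2 * \<bar>D k * a k k\<bar>"
      using \<sigma>(3) by (simp add: abs_mult)
    then show False using \<sigma> that(2) by linarith
  qed
  have A0: "measure P (A m) = 0" for m
  proof (rule null_if_frequently_displaced[where T = flip and N = "\<lambda>_. borel"])
    show "sets P = sets (PiM UNIV (\<lambda>_. borel))" by (simp add: P_def S_def)
    show "\<exists>\<^sub>F i in sequentially. \<forall>x\<in>A m. flip i x \<notin> A m"
      by (rule frequently_elim1[OF frequently_eventually_frequently[OF freq eventually_ge_at_top[of m]]])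
        (use disj in blast)
  qed (use flip inv A P.prob_space_axioms in \<open>auto simp: flip_def\<close>)
  have "AE \<sigma> in P. \<sigma> \<notin> A m" for m
    by (rule AE_not_in) (simp add: null_sets_def P.emeasure_eq_measure A0)
  then have "AE \<sigma> in P. \<forall>m. \<sigma> \<notin> A m" by (simp add: AE_all_countable)
  then have "AE \<omega> in M. \<forall>m. (\<lambda>i. \<gamma> i \<omega>) \<notin> A m"
    unfolding P_def by (rule AE_distrD[OF \<gamma>])
  moreover have "AE \<omega> in M. \<forall>i. \<gamma> i \<omega> = 1 \<or> \<gamma> i \<omega> = - 1"
    using AE_sign by (simp add: AE_all_countable)
  moreover have "AE \<omega> in M. \<forall>n. summable (\<lambda>i. \<gamma> i \<omega> * a n i)"
    using summ by (simp add: AE_all_countable)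
  ultimately show ?thesis
    using AE_space
  proof eventually_elim
    case (elim \<omega>)
    have "(\<lambda>i. \<gamma> i \<omega>) \<in> space P"
      using measurable_space[OF \<gamma> elim(4)] by (simp add: P_def)
    moreover have "\<bar>\<gamma> i \<omega>\<bar> = 1" for i using elim(2)[rule_format, of i] by auto
    ultimately show ?case using elim(1,3) by (auto simp: A_def eventually_sequentially)
  qed
qed

text \<open>Random partial sums grow no faster than n^\<beta> for any \<beta> > 1/2, while the
  coefficients decay like n^(-p); the condition p > 1/2 leaves room for such a \<beta> below
  p.\<close>

lemma AE_summable_arrivals:
  fixes G w :: "nat \<Rightarrow> real"
  assumes w: "\<And>i. \<bar>w i\<bar> \<le> 1" and p: "1 / 2 < p"
    and G: "\<And>i. 0 < G i" "\<And>i. G i \<le> G (Suc i)"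
    and growth: "\<forall>\<^sub>F i in sequentially. \<delta> * real (Suc i) \<le> G i" "0 < \<delta>"
  shows "AE \<omega> in M. summable (\<lambda>i. \<gamma> i \<omega> * w i * G i powr (- p))"
proof -
  \<comment> \<open>The midpoint of 1/2 and min 1 p: above 1/2 for the bound on the sign sums, below
    \<open>p\<close> and at most 1 for the summation by parts.\<close>
  define \<beta> where "\<beta> = (1 / 2 + min 1 p) / 2"
  have \<beta>: "1 / 2 < \<beta>" "\<beta> \<le> 1" "\<beta> < p" using p by (auto simp: \<beta>_def min_def)
  \<comment> \<open>The growth bound holds only eventually, whereas the summation by parts asks for
    a bound at every index. Boundedness of the quotient absorbs the finitely many exceptions into
    \<open>C\<close>.\<close>
  have "Bseq (\<lambda>i. G i powr (- p) * real (Suc i) powr p)"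
  proof (rule Bseq_eventually_mono)
    show "\<forall>\<^sub>F i in sequentially. norm (G i powr (- p) * real (Suc i) powr p) \<le> norm (\<delta> powr (- p))"
      using growth(1)
    proof eventually_elim
      case (elim i)
      have "G i powr (- p) \<le> (\<delta> * real (Suc i)) powr (- p)"
        using elim growth(2) p by (intro powr_mono2') auto
      also have "\<dots> = \<delta> powr (- p) * real (Suc i) powr (- p)"
        using growth(2) by (simp add: powr_mult)
      finally have "G i powr (- p) * real (Suc i) powr p \<le>
          \<delta> powr (- p) * real (Suc i) powr (- p) * real (Suc i) powr p"
        by (rule mult_right_mono) simp
      also have "\<dots> = \<delta> powr (- p)" by (simp add: powr_minus)
      finally show ?case by simp
    qed
  qed simp
  then obtain C where C: "\<And>i. norm (G i powr (- p) * real (Suc i) powr p) \<le> C"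
    by (auto simp: Bseq_def)
  have bound: "G i powr (- p) \<le> C * real (Suc i) powr (- p)" for i
    using C[of i] by (simp add: powr_minus divide_simps)
  show ?thesis
    using AE_weighted_sum_le[of w \<beta>, OF w \<beta>(1)]
  proof eventually_elim
    case (elim \<omega>)
    show ?case
    proof (rule summable_mult_by_parts[OF _ \<beta>(2,3) _ _ bound elim])
      show "G (Suc i) powr (- p) \<le> G i powr (- p)" for i
        using G p by (intro powr_mono2') auto
    qed (use \<beta> in auto)
  qed
qed

end

subsection \<open>Arrival times and uniform marks\<close>

sublocale levy_series \<subseteq> rademacher_sequence M \<gamma>
  by unfold_locales (rule \<gamma>_indep \<gamma>_pos \<gamma>_neg)+

lemma arrival_eq_sum: "\<Gamma> n \<omega> = (\<Sum>j\<le>n. interarrival \<Gamma> j \<omega>)"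
  by (induction n) (simp_all add: interarrival_def)

context levy_series
begin

section \<open>Linear growth of the arrival times\<close>

lemma interarrival_exponential:
  "distributed M lborel (interarrival \<Gamma> j) (exponential_density 1)"
  using arrival by (simp add: poisson_arrival_times_def)

lemma interarrival_indep: "indep_vars (\<lambda>_. borel) (interarrival \<Gamma>) UNIV"
  using arrival by (simp add: poisson_arrival_times_def)

lemma interarrival_measurable[measurable]: "interarrival \<Gamma> j \<in> borel_measurable M"
  using distributed_measurable[OF interarrival_exponential] by simp

lemma arrival_measurable[measurable]: "\<Gamma> n \<in> borel_measurable M"
proof -
  have "\<Gamma> n = (\<lambda>\<omega>. \<Sum>j\<le>n. interarrival \<Gamma> j \<omega>)" by (rule ext) (rule arrival_eq_sum)
  then show ?thesis by simp
qed

lemma AE_arrival_increasing: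
  "AE \<omega> in M. \<forall>n. 0 < \<Gamma> n \<omega> \<and> \<Gamma> n \<omega> \<le> \<Gamma> (Suc n) \<omega>"
proof -
  have "AE \<omega> in M. 0 < interarrival \<Gamma> j \<omega>" for j
    using exponential_distributedD_gt[OF interarrival_exponential[of j], of 0]
    by (simp add: prob_Collect_eq_1)
  then have "AE \<omega> in M. \<forall>j. 0 < interarrival \<Gamma> j \<omega>" by (simp add: AE_all_countable)
  then show ?thesis
  proof eventually_elim
    case (elim \<omega>)
    have "0 < \<Gamma> n \<omega>" for n
      by (subst arrival_eq_sum[of \<Gamma> n \<omega>], rule sum_pos) (use elim in auto)
    moreover have "\<Gamma> n \<omega> \<le> \<Gamma> (Suc n) \<omega>" for n
      using elim[rule_format, of "Suc n"] by (simp add: interarrival_def)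
    ultimately show ?case by blast
  qed
qed

text \<open>The exponential moment factorises over the independent waiting times, and tilting the
  density of rate 1 by exp (l x) gives 1 / (1 - l) times the density of rate 1 - l. Negative
  \<open>l\<close> is allowed, so both tails are covered.\<close>

lemma nn_integral_exp_arrival:
  assumes "l < 1"
  shows "(\<integral>\<^sup>+\<omega>. exp (l * \<Gamma> n \<omega>) \<partial>M) = ennreal ((1 / (1 - l)) ^ Suc n)"
proof -
  have one: "(\<integral>\<^sup>+\<omega>. exp (l * interarrival \<Gamma> j \<omega>) \<partial>M) = ennreal (1 / (1 - l))" for j
  proof -
    interpret E: prob_space "density lborel (exponential_density (1 - l))"
      using assms by (intro prob_space_exponential_density) simp
    have "(\<integral>\<^sup>+\<omega>. exp (l * interarrival \<Gamma> j \<omega>) \<partial>M) =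
        (\<integral>\<^sup>+x. ennreal (exponential_density 1 x) * ennreal (exp (l * x)) \<partial>lborel)"
      by (rule distributed_nn_integral[OF interarrival_exponential, symmetric]) simp
    also have "\<dots> = (\<integral>\<^sup>+x. ennreal (1 / (1 - l)) * ennreal (exponential_density (1 - l) x) \<partial>lborel)"
    proof (rule nn_integral_cong)
      fix x :: real
      have "exponential_density 1 x * exp (l * x) = 1 / (1 - l) * exponential_density (1 - l) x"
        using assms by (simp add: exponential_density_def exp_add[symmetric]) (simp add: algebra_simps)
      moreover have "0 \<le> exponential_density (1 - l) x"
        using assms by (simp add: exponential_density_nonneg)
      ultimately show "ennreal (exponential_density 1 x) * ennreal (exp (l * x)) =
          ennreal (1 / (1 - l)) * ennreal (exponential_density (1 - l) x)"
        using assms by (simp add: ennreal_mult[symmetric] exponential_density_nonneg del: times_divide_eq_left)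
    qed
    also have "\<dots> = ennreal (1 / (1 - l)) * (\<integral>\<^sup>+x. ennreal (exponential_density (1 - l) x) \<partial>lborel)"
      by (rule nn_integral_cmult) simp
    also have "(\<integral>\<^sup>+x. ennreal (exponential_density (1 - l) x) \<partial>lborel) = 1"
      using E.emeasure_space_1 by (simp add: emeasure_density)
    finally show ?thesis by simp
  qed
  have "indep_vars (\<lambda>_. borel) (\<lambda>j \<omega>. (\<lambda>x. ennreal (exp (l * x))) (interarrival \<Gamma> j \<omega>)) UNIV"
    by (rule indep_vars_compose2[OF interarrival_indep]) simp
  then have ind: "indep_vars (\<lambda>_. borel) (\<lambda>j \<omega>. ennreal (exp (l * interarrival \<Gamma> j \<omega>))) {..n}"
    by (rule indep_vars_subset) simp
  have "(\<integral>\<^sup>+\<omega>. exp (l * \<Gamma> n \<omega>) \<partial>M) = (\<integral>\<^sup>+\<omega>. (\<Prod>j\<le>n. ennreal (exp (l * interarrival \<Gamma> j \<omega>))) \<partial>M)"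
  proof (rule nn_integral_cong)
    fix \<omega>
    have "l * \<Gamma> n \<omega> = (\<Sum>j\<le>n. l * interarrival \<Gamma> j \<omega>)"
      by (subst arrival_eq_sum) (rule sum_distrib_left)
    then show "ennreal (exp (l * \<Gamma> n \<omega>)) = (\<Prod>j\<le>n. ennreal (exp (l * interarrival \<Gamma> j \<omega>)))"
      by (simp add: exp_sum prod_ennreal)
  qed
  also have "\<dots> = (\<Prod>j\<le>n. \<integral>\<^sup>+\<omega>. ennreal (exp (l * interarrival \<Gamma> j \<omega>)) \<partial>M)"
    by (rule indep_vars_nn_integral[OF _ ind]) auto
  also have "\<dots> = ennreal ((1 / (1 - l)) ^ Suc n)"
    using assms by (simp add: one prod_ennreal prod_constant ennreal_power del: power_Suc)
  finally show ?thesis .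
qed

text \<open>Chernoff bound: a positive \<open>l\<close> controls the upper tail, a negative one the
  lower tail.\<close>

lemma prob_exp_arrival_ge:
  assumes "l < 1"
  shows "prob {\<omega> \<in> space M. x * real (Suc n) \<le> l * \<Gamma> n \<omega>} \<le> (exp (- x) / (1 - l)) ^ Suc n"
proof -
  let ?A = "{\<omega> \<in> space M. x * real (Suc n) \<le> l * \<Gamma> n \<omega>}"
  have "ennreal (prob ?A) = (\<integral>\<^sup>+\<omega>. indicator ?A \<omega> \<partial>M)"
    by (subst nn_integral_indicator) (auto simp: emeasure_eq_measure)
  also have "\<dots> \<le> (\<integral>\<^sup>+\<omega>. ennreal (exp (- x * real (Suc n))) * ennreal (exp (l * \<Gamma> n \<omega>)) \<partial>M)"
  proof (rule nn_integral_mono)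
    fix \<omega>
    have "1 \<le> exp (- x * real (Suc n)) * exp (l * \<Gamma> n \<omega>)" if "\<omega> \<in> ?A"
      using that by (simp add: exp_add[symmetric] algebra_simps)
    then show "(indicator ?A \<omega> :: ennreal) \<le> ennreal (exp (- x * real (Suc n))) * ennreal (exp (l * \<Gamma> n \<omega>))"
      by (cases "\<omega> \<in> ?A") (simp_all add: ennreal_mult[symmetric] ennreal_ge_1)
  qed
  also have "\<dots> = ennreal (exp (- x * real (Suc n))) * ennreal ((1 / (1 - l)) ^ Suc n)"
    by (subst nn_integral_cmult) (simp_all add: nn_integral_exp_arrival[OF assms] del: power_Suc)
  also have "\<dots> = ennreal (exp (- x) ^ Suc n * (1 / (1 - l)) ^ Suc n)"
    unfolding exp_of_nat2_mult using assms by (intro ennreal_mult[symmetric]) auto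
  also have "exp (- x) ^ Suc n * (1 / (1 - l)) ^ Suc n = (exp (- x) / (1 - l)) ^ Suc n"
    by (simp add: power_mult_distrib[symmetric] del: power_Suc)
  finally show ?thesis using assms by (subst (asm) ennreal_le_iff) auto
qed

lemma AE_arrival_less:
  assumes "l < 1" "exp (- x) / (1 - l) < 1"
  shows "AE \<omega> in M. \<forall>\<^sub>F n in sequentially. l * \<Gamma> n \<omega> < x * real (Suc n)"
proof -
  let ?A = "\<lambda>n. {\<omega> \<in> space M. x * real (Suc n) \<le> l * \<Gamma> n \<omega>}"
  have "summable (\<lambda>n. prob (?A n))"
  proof (rule summable_comparison_test')
    show "summable (\<lambda>n. (exp (- x) / (1 - l)) ^ Suc n)"
      using assms by (subst summable_Suc_iff) (simp add: summable_geometric)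
  qed (use prob_exp_arrival_ge[OF assms(1)] in simp)
  then have "AE \<omega> in M. \<forall>\<^sub>F n in sequentially. \<omega> \<in> space M - ?A n"
    by (intro borel_cantelli_AE1) (auto simp: emeasure_eq_measure)
  then show ?thesis
  proof eventually_elim
    case (elim \<omega>)
    then show ?case by eventually_elim auto
  qed
qed

lemma AE_arrival_linear_growth:
  "AE \<omega> in M. \<forall>\<^sub>F n in sequentially. real (Suc n) / 4 \<le> \<Gamma> n \<omega> \<and> \<Gamma> n \<omega> \<le> 4 * real (Suc n)"
proof -
  have e1: "exp (1 / 4 :: real) < 2"
    using exp_bound[of "1 / 4"] by (simp add: power2_eq_square)
  have e2: "2 < exp (2::real)" using exp_ge_add_one_self[of 2] by linarith
  \<comment> \<open>Lower bound, with l = -1 and x = -1/4: the geometric ratio is exp (1/4) / 2 <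
    1.\<close>
  have "AE \<omega> in M. \<forall>\<^sub>F n in sequentially. - 1 * \<Gamma> n \<omega> < (- 1 / 4) * real (Suc n)"
    by (rule AE_arrival_less) (use e1 in auto)
  \<comment> \<open>Upper bound, with l = 1/2 and x = 2: the geometric ratio is 2 exp (-2) <
    1.\<close>
  moreover have "AE \<omega> in M. \<forall>\<^sub>F n in sequentially. 1 / 2 * \<Gamma> n \<omega> < 2 * real (Suc n)"
    by (rule AE_arrival_less) (use e2 in \<open>auto simp: exp_minus divide_simps\<close>)
  ultimately show ?thesis
  proof eventually_elim
    case (elim \<omega>)
    then show ?case by eventually_elim auto
  qed
qed

section \<open>Marks falling just to the right of a given time\<close>

lemma V_measurable[measurable]: "V i \<in> borel_measurable M"
  using V_indep by (auto simp: indep_vars_def)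

lemma prob_V_in_interval:
  assumes "0 \<le> a" "a \<le> b" "b \<le> 1"
  shows "prob (V i -` {a<..b} \<inter> space M) = b - a"
proof -
  have "prob (V i -` {a<..b} \<inter> space M) = measure (distr M borel (V i)) {a<..b}"
    by (subst measure_distr) auto
  also have "\<dots> = measure lborel ({0..1} \<inter> {a<..b}) / measure lborel {0..1::real}"
    unfolding V_uniform by (rule measure_uniform_measure) auto
  also have "{0..1} \<inter> {a<..b} = {a<..b}" using assms by auto
  finally show ?thesis using assms by simp
qed

text \<open>The divergence half of Borel-Cantelli: by independence the probability of no hit among
  \<open>N\<close> indices from \<open>n\<close> on is the product of the 1 - r i, at most exp of
  minus their sum. If never hitting had positive probability, its logarithm would bound all partial
  sums of \<open>r\<close>.\<close>

lemma AE_V_frequently_near: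
  fixes r :: "nat \<Rightarrow> real"
  assumes t: "0 \<le> t" and r: "\<And>i. 0 \<le> r i" "\<And>i. r i \<le> 1 - t" and div: "\<not> summable r"
  shows "AE \<omega> in M. \<exists>\<^sub>F i in sequentially. V i \<omega> \<in> {t<..t + r i}"
proof -
  have "AE \<omega> in M. \<exists>i\<ge>n. V i \<omega> \<in> {t<..t + r i}" for n
  proof -
    define B where "B = {\<omega> \<in> space M. \<forall>i\<ge>n. V i \<omega> \<notin> {t<..t + r i}}"
    have [measurable]: "B \<in> events" unfolding B_def by measurable
    have bound: "prob B \<le> exp (- (\<Sum>i<N. r (i + n)))" for N
    proof (cases "N = 0")
      case False
      have "prob B \<le> prob (\<Inter>i\<in>{n..<N + n}. V i -` (- {t<..t + r i}) \<inter> space M)"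
        by (rule finite_measure_mono) (auto simp: B_def False intro!: sets.finite_INT)
      also have "\<dots> = (\<Prod>i\<in>{n..<N + n}. prob (V i -` (- {t<..t + r i}) \<inter> space M))"
        by (rule indep_varsD[OF V_indep]) (use False in auto)
      also have "\<dots> = (\<Prod>i\<in>{n..<N + n}. 1 - r i)"
      proof (rule prod.cong[OF refl])
        fix i
        have "V i -` (- {t<..t + r i}) \<inter> space M = space M - V i -` {t<..t + r i} \<inter> space M" by auto
        then show "prob (V i -` (- {t<..t + r i}) \<inter> space M) = 1 - r i"
          using prob_V_in_interval[of t "t + r i" i] t r[of i] by (simp add: prob_compl)
      qed
      also have "\<dots> \<le> (\<Prod>i\<in>{n..<N + n}. exp (- r i))"
      proof (rule prod_mono)
        fix i show "0 \<le> 1 - r i \<and> 1 - r i \<le> exp (- r i)"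
          using exp_ge_add_one_self[of "- r i"] r(2)[of i] t by auto
      qed
      also have "\<dots> = exp (- (\<Sum>i\<in>{n..<N + n}. r i))" by (simp add: exp_sum sum_negf[symmetric])
      also have "(\<Sum>i\<in>{n..<N + n}. r i) = (\<Sum>i<N. r (i + n))"
        using sum.shift_bounds_nat_ivl[of r 0 n N] by (simp add: atLeast0LessThan)
      finally show ?thesis .
    qed simp
    have "prob B = 0"
    proof (rule ccontr)
      assume "prob B \<noteq> 0"
      then have pos: "0 < prob B" by (simp add: zero_less_measure_iff)
      have "(\<Sum>i<N. r (i + n)) \<le> - ln (prob B)" for N
        using ln_mono[OF bound[of N] pos] by simp
      then have "summable (\<lambda>i. r (i + n))"
        by (intro summableI_nonneg_bounded) (use r in auto)
      then show False using div by (simp add: summable_iff_shift)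
    qed
    then have "AE \<omega> in M. \<omega> \<notin> B"
      by (intro AE_not_in) (simp add: null_sets_def emeasure_eq_measure)
    then show ?thesis using AE_space by eventually_elim (auto simp: B_def)
  qed
  then have "AE \<omega> in M. \<forall>n. \<exists>i\<ge>n. V i \<omega> \<in> {t<..t + r i}" by (simp add: AE_all_countable)
  then show ?thesis by eventually_elim (simp add: frequently_sequentially)
qed

section \<open>Conditioning on arrival times and marks\<close>

text \<open>The index set {0, 1, 2} is split into the blocks {0, 1} and {2}. Independent blocks have
  a product law, which is pushed forward by reading off the components.\<close>

lemma joint_distr:
  "distr M (PiM UNIV (\<lambda>_. borel) \<Otimes>\<^sub>M PiM UNIV (\<lambda>_. borel)) (\<lambda>\<omega>. ((\<lambda>i. \<Gamma> i \<omega>), (\<lambda>i. V i \<omega>))) \<Otimes>\<^sub>M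
      distr M (PiM UNIV (\<lambda>_. borel)) (\<lambda>\<omega> i. \<gamma> i \<omega>) =
    distr M ((PiM UNIV (\<lambda>_. borel) \<Otimes>\<^sub>M PiM UNIV (\<lambda>_. borel)) \<Otimes>\<^sub>M PiM UNIV (\<lambda>_. borel))
      (\<lambda>\<omega>. (((\<lambda>i. \<Gamma> i \<omega>), (\<lambda>i. V i \<omega>)), (\<lambda>i. \<gamma> i \<omega>)))"
proof -
  let ?S = "PiM UNIV (\<lambda>_::nat. borel :: real measure)"
  let ?X = "\<lambda>k \<omega> i. ([\<Gamma>, V, \<gamma>] ! k) i \<omega>"
  let ?A = "\<lambda>\<omega>. \<lambda>k\<in>{0, 1}. ?X k \<omega>" and ?B = "\<lambda>\<omega>. \<lambda>k\<in>{2}. ?X k \<omega>"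
  let ?f = "\<lambda>x :: nat \<Rightarrow> nat \<Rightarrow> real. (x 0, x 1)" and ?g = "\<lambda>x :: nat \<Rightarrow> nat \<Rightarrow> real. x 2"
  let ?S01 = "PiM {0, 1::nat} (\<lambda>_. ?S)" and ?S2 = "PiM {2::nat} (\<lambda>_. ?S)"
  have "indep_var ?S01 ?A ?S2 ?B"
    by (rule indep_var_restrict[OF sequences_indep]) auto
  then have A: "?A \<in> measurable M ?S01" and B: "?B \<in> measurable M ?S2"
    and AB: "distr M ?S01 ?A \<Otimes>\<^sub>M distr M ?S2 ?B = distr M (?S01 \<Otimes>\<^sub>M ?S2) (\<lambda>\<omega>. (?A \<omega>, ?B \<omega>))"
    unfolding indep_var_distribution_eq by blast+
  have f: "?f \<in> measurable ?S01 (?S \<Otimes>\<^sub>M ?S)"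
    by (intro measurable_Pair measurable_component_singleton) auto
  have g: "?g \<in> measurable ?S2 ?S" by (rule measurable_component_singleton) simp
  interpret B: prob_space "distr M ?S2 ?B" using B by (rule prob_space_distr)
  interpret gB: prob_space "distr (distr M ?S2 ?B) ?S ?g" using g by (intro B.prob_space_distr) simp
  have "distr M (?S \<Otimes>\<^sub>M ?S) (?f \<circ> ?A) \<Otimes>\<^sub>M distr M ?S (?g \<circ> ?B) =
      distr (distr M ?S01 ?A) (?S \<Otimes>\<^sub>M ?S) ?f \<Otimes>\<^sub>M distr (distr M ?S2 ?B) ?S ?g"
    by (simp only: distr_distr[OF f A] distr_distr[OF g B])
  also have "\<dots> = distr (distr M (?S01 \<Otimes>\<^sub>M ?S2) (\<lambda>\<omega>. (?A \<omega>, ?B \<omega>))) ((?S \<Otimes>\<^sub>M ?S) \<Otimes>\<^sub>M ?S)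
      (\<lambda>(x, y). (?f x, ?g y))"
    unfolding AB[symmetric]
    by (rule pair_measure_distr) (use f g gB.sigma_finite_measure_axioms in auto)
  also have "\<dots> = distr M ((?S \<Otimes>\<^sub>M ?S) \<Otimes>\<^sub>M ?S) ((\<lambda>(x, y). (?f x, ?g y)) \<circ> (\<lambda>\<omega>. (?A \<omega>, ?B \<omega>)))"
  proof (rule distr_distr)
    show "(\<lambda>(x, y). (?f x, ?g y)) \<in> measurable (?S01 \<Otimes>\<^sub>M ?S2) ((?S \<Otimes>\<^sub>M ?S) \<Otimes>\<^sub>M ?S)"
      using measurable_Pair[OF measurable_compose[OF measurable_fst f] measurable_compose[OF measurable_snd g]]
      by (simp add: case_prod_beta')
    show "(\<lambda>\<omega>. (?A \<omega>, ?B \<omega>)) \<in> measurable M (?S01 \<Otimes>\<^sub>M ?S2)"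
      using A B by (rule measurable_Pair)
  qed
  finally show ?thesis by (simp add: comp_def)
qed

text \<open>Fubini for the product law of \<open>joint_distr\<close>: the signs may be replaced by
  an independent copy \<sigma> while \<Gamma> and \<open>V\<close> are frozen.\<close>

lemma AE_by_conditioning:
  fixes P :: "((nat \<Rightarrow> real) \<times> (nat \<Rightarrow> real)) \<times> (nat \<Rightarrow> real) \<Rightarrow> bool"
  assumes P: "Measurable.pred ((PiM UNIV (\<lambda>_. borel) \<Otimes>\<^sub>M PiM UNIV (\<lambda>_. borel)) \<Otimes>\<^sub>M PiM UNIV (\<lambda>_. borel)) P"
    and AE: "AE \<omega> in M. AE \<sigma> in distr M (PiM UNIV (\<lambda>_. borel)) (\<lambda>\<omega> i. \<gamma> i \<omega>).
      P (((\<lambda>i. \<Gamma> i \<omega>), (\<lambda>i. V i \<omega>)), \<sigma>)"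
  shows "AE \<omega> in M. P (((\<lambda>i. \<Gamma> i \<omega>), (\<lambda>i. V i \<omega>)), (\<lambda>i. \<gamma> i \<omega>))"
proof -
  let ?S = "PiM UNIV (\<lambda>_::nat. borel :: real measure)"
  let ?X = "\<lambda>\<omega>. ((\<lambda>i. \<Gamma> i \<omega>), (\<lambda>i. V i \<omega>))"
  let ?K = "distr M (?S \<Otimes>\<^sub>M ?S) ?X" and ?R = "distr M ?S (\<lambda>\<omega> i. \<gamma> i \<omega>)"
  have X: "?X \<in> measurable M (?S \<Otimes>\<^sub>M ?S)"
    by (intro measurable_Pair measurable_PiM_UNIV) measurable
  have g: "(\<lambda>\<omega> i. \<gamma> i \<omega>) \<in> measurable M ?S"
    by (rule measurable_PiM_UNIV) measurable
  interpret K: prob_space ?K using X by (rule prob_space_distr)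
  interpret R: prob_space ?R using g by (rule prob_space_distr)
  interpret KR: pair_prob_space ?K ?R ..
  have P'[measurable]: "Measurable.pred (?K \<Otimes>\<^sub>M ?R) P"
    using P by (simp cong: measurable_cong_sets)
  \<comment> \<open>Rewriting the inner statement as the vanishing of a section measure shows that
    the set of good \<open>x\<close> is measurable, which the transfer from \<open>M\<close> to the
    law \<open>?K\<close> requires.\<close>
  have eq: "(AE \<sigma> in ?R. P (x, \<sigma>)) \<longleftrightarrow> emeasure ?R (Pair x -` {z \<in> space (?K \<Otimes>\<^sub>M ?R). \<not> P z}) = 0"
    if "x \<in> space (?S \<Otimes>\<^sub>M ?S)" for x
  proof (rule AE_iff_measurable)
    show "Pair x -` {z \<in> space (?K \<Otimes>\<^sub>M ?R). \<not> P z} \<in> sets ?R"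
      by (rule sets_Pair1) measurable
    show "{\<sigma> \<in> space ?R. \<not> P (x, \<sigma>)} = Pair x -` {z \<in> space (?K \<Otimes>\<^sub>M ?R). \<not> P z}"
      using that by (auto simp: space_pair_measure)
  qed
  have "(\<lambda>x. emeasure ?R (Pair x -` {z \<in> space (?K \<Otimes>\<^sub>M ?R). \<not> P z})) \<in> borel_measurable ?K"
    by (rule R.measurable_emeasure_Pair) measurable
  then have em[measurable]: "(\<lambda>x. emeasure ?R (Pair x -` {z \<in> space (?K \<Otimes>\<^sub>M ?R). \<not> P z})) \<in> borel_measurable (?S \<Otimes>\<^sub>M ?S)"
    by simp
  have "{x \<in> space (?S \<Otimes>\<^sub>M ?S). AE \<sigma> in ?R. P (x, \<sigma>)} =
      {x \<in> space (?S \<Otimes>\<^sub>M ?S). emeasure ?R (Pair x -` {z \<in> space (?K \<Otimes>\<^sub>M ?R). \<not> P z}) = 0}"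
    using eq by blast
  also have "\<dots> \<in> sets (?S \<Otimes>\<^sub>M ?S)" by measurable
  finally have "AE x in ?K. AE \<sigma> in ?R. P (x, \<sigma>)"
    using AE by (subst AE_distr_iff[OF X])
  then have "AE z in ?K \<Otimes>\<^sub>M ?R. P z"
    by (intro KR.AE_pair_measure) (use P' in \<open>auto simp: pred_def\<close>)
  then have "AE z in distr M ((?S \<Otimes>\<^sub>M ?S) \<Otimes>\<^sub>M ?S) (\<lambda>\<omega>. (?X \<omega>, (\<lambda>i. \<gamma> i \<omega>))). P z"
    unfolding joint_distr .
  then show ?thesis
    by (rule AE_distrD[rotated]) (rule measurable_Pair[OF X g])
qed

end

subsection \<open>Increments of the motion\<close>

text \<open>Raised to the power \<open>a i\<close>, the claim says that G i is below the constant
  times r^(-h a i), with r the base on the left. This is at least of order i^(q h a i), an exponent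
  eventually above 1 by a fixed margin, while \<open>G i\<close> grows at most linearly.\<close>

lemma eventually_jump_gt:
  fixes a G :: "nat \<Rightarrow> real" and l h q \<rho> \<kappa> :: real
  assumes a: "a \<longlonglongrightarrow> l" "\<And>i. 0 < a i" and q: "0 < h" "0 < q" "1 < q * h * l"
    and \<rho>: "0 < \<rho>" "\<rho> \<le> 1" and \<kappa>: "0 < \<kappa>" "\<And>i. \<kappa> \<le> stable_const (a i)"
    and G: "\<forall>\<^sub>F i in sequentially. G i \<le> 4 * real (Suc i)" "\<And>i. 0 < G i"
  shows "\<forall>\<^sub>F i in sequentially. (\<rho> * real (Suc i) powr (- q)) powr h
    < stable_const (a i) powr (1 / a i) * G i powr (- (1 / a i))"
proof -
  \<comment> \<open>Half of the surplus in q h l > 1; the other half allows for \<open>a i\<close>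
    differing from its limit.\<close>
  define \<delta> where "\<delta> = (q * h * l - 1) / 2"
  have \<delta>: "0 < \<delta>" "1 + \<delta> < q * h * l" using q(3) by (auto simp: \<delta>_def field_simps)
  have "(\<lambda>i. q * h * a i) \<longlonglongrightarrow> q * h * l" by (intro tendsto_intros a)
  then have "\<forall>\<^sub>F i in sequentially. 1 + \<delta> < q * h * a i"
    using \<delta>(2) by (rule order_tendstoD)
  moreover have "\<forall>\<^sub>F i in sequentially. 4 * real (Suc i) < \<kappa> * real (Suc i) powr (1 + \<delta>)"
    using \<delta>(1) \<kappa>(1) by real_asymp
  ultimately show ?thesis using G(1)
  proof eventually_elim
    case (elim i)
    let ?r = "\<rho> * real (Suc i) powr (- q)"
    have r: "0 < ?r" using \<rho> by simp
    have "real (Suc i) powr (1 + \<delta>) \<le> real (Suc i) powr (q * h * a i)"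
      using elim(1) by (intro powr_mono) auto
    also have "\<dots> = (real (Suc i) powr (- q)) powr (- (h * a i))"
      by (simp add: powr_powr mult.assoc)
    also have "\<dots> \<le> ?r powr (- (h * a i))"
      using \<rho> q a(2)[of i] by (intro powr_mono2') auto
    finally have "\<kappa> * real (Suc i) powr (1 + \<delta>) \<le> stable_const (a i) * ?r powr (- (h * a i))"
      using less_le_trans[OF \<kappa>(1) \<kappa>(2)[of i]] by (intro mult_mono[OF \<kappa>(2)]) auto
    then have "G i < stable_const (a i) * ?r powr (- (h * a i))" using elim by linarith
    then have "G i powr (1 / a i) < (stable_const (a i) * ?r powr (- (h * a i))) powr (1 / a i)"
      using G(2)[of i] a(2)[of i] by (intro powr_less_mono2) auto
    also have "\<dots> = stable_const (a i) powr (1 / a i) * ?r powr (- h)"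
      using \<kappa> a(2)[of i] less_le_trans[OF \<kappa>(1) \<kappa>(2)[of i]] by (simp add: powr_mult powr_powr)
    finally show ?case
      using r G(2)[of i] by (simp add: powr_minus field_simps)
  qed
qed

context levy_series
begin

text \<open>It is enough to refute the limit along one sequence \<open>r\<close>. With arrival times
  and marks frozen, the increments along it are sign series to which
  \<open>AE_not_eventually_small\<close> applies, and \<open>AE_by_conditioning\<close> carries the
  result back.\<close>

lemma AE_not_small_increments:
  fixes \<alpha> :: "real \<Rightarrow> real"
  assumes t: "0 < t" "t < 1" and \<alpha>: "\<And>u. u \<in> {0..1} \<Longrightarrow> 0 < \<alpha> u" "\<And>u. u \<in> {0..1} \<Longrightarrow> \<alpha> u \<le> d"
    and d: "d < 2" and cont: "continuous_on {0..1} \<alpha>" and h: "1 / \<alpha> t < h"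
  defines "Y \<equiv> multistable_levy_motion \<alpha> \<Gamma> V \<gamma>"
  shows "AE \<omega> in M. \<not> ((\<lambda>r. \<bar>Y (t + r) \<omega> - Y t \<omega>\<bar> / \<bar>r\<bar> powr h) \<longlongrightarrow> 0) (at 0)"
proof -
  have \<alpha>t: "0 < \<alpha> t" using \<alpha>(1) t by simp
  have h0: "0 < h" using \<alpha>t h by (auto intro: less_trans[of 0 "1 / \<alpha> t"])
  have "1 / (h * \<alpha> t) < 1" using h h0 \<alpha>t by (simp add: field_simps)
  then obtain q where q: "1 / (h * \<alpha> t) < q" "q < 1" using dense by blast
  have q0: "0 < q" using q(1) h0 \<alpha>t by (auto intro: less_trans[of 0 "1 / (h * \<alpha> t)"])
  have qh: "1 < q * h * \<alpha> t" using q(1) h0 \<alpha>t by (simp add: field_simps)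
  \<comment> \<open>The factor 1 - t keeps t + r i in [0,1], where both \<alpha> and the law of the
    marks are under control.\<close>
  define r where "r i = (1 - t) * real (Suc i) powr (- q)" for i
  have r_pos: "0 < r i" for i using t by (simp add: r_def)
  have r_le: "r i \<le> 1 - t" for i
  proof -
    have "real (Suc i) powr (- q) \<le> real (Suc i) powr 0" using q0 by (intro powr_mono) auto
    then show ?thesis using t by (simp add: r_def mult_left_le)
  qed
  have r_lim: "r \<longlonglongrightarrow> 0"
  proof -
    have "(\<lambda>i. real (Suc i) powr (- q)) \<longlonglongrightarrow> 0"
      by (rule LIMSEQ_Suc) (use q0 in \<open>intro tendsto_neg_powr filterlim_real_sequentially, auto\<close>)
    then show ?thesis unfolding r_def[abs_def] by (rule tendsto_mult_right_zero)
  qed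
  have r_div: "\<not> summable r"
  proof
    assume "summable r"
    then have "summable (\<lambda>i. (1 / (1 - t)) * r i)" by (rule summable_mult)
    then have "summable (\<lambda>i. real (Suc i) powr (- q))" using t by (simp add: r_def)
    then show False
      using q(2) by (subst (asm) summable_Suc_iff[of "\<lambda>i. real i powr (- q)"]) (simp add: summable_real_powr_iff)
  qed
  define s where "s n = t + r n" for n
  have s: "s n \<in> {0..1}" for n using r_pos[of n] r_le[of n] t by (simp add: s_def)
  have \<alpha>s: "0 < \<alpha> (s n)" "\<alpha> (s n) \<le> d" for n using \<alpha> s by auto
  have \<alpha>_lim: "(\<lambda>n. \<alpha> (s n)) \<longlonglongrightarrow> \<alpha> t"
  proof (rule continuous_on_tendsto_compose[OF cont])
    show "s \<longlonglongrightarrow> t" unfolding s_def[abs_def] using tendsto_add[OF tendsto_const r_lim, of t] by simp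
  qed (use s t in auto)
  define a where "a G v n i = G i powr (- (1 / \<alpha> (s n))) * indicator {0..s n} (v i)"
    for G v :: "nat \<Rightarrow> real" and n i :: nat
  define b where "b G v i = G i powr (- (1 / \<alpha> t)) * indicator {0..t} (v i)"
    for G v :: "nat \<Rightarrow> real" and i :: nat
  define D where "D u = stable_const (\<alpha> u) powr (1 / \<alpha> u)" for u
  define \<epsilon> where "\<epsilon> n = r n powr h" for n
  define F where "F n G v \<sigma> = D (s n) * (\<Sum>i. \<sigma> i * a G v n i) - D t * (\<Sum>i. \<sigma> i * b G v i)"
    for n and G v \<sigma> :: "nat \<Rightarrow> real"
  have Y: "Y (t + r n) \<omega> - Y t \<omega> = F n (\<lambda>i. \<Gamma> i \<omega>) (\<lambda>i. V i \<omega>) (\<lambda>i. \<gamma> i \<omega>)" for n \<omega>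
    by (simp add: Y_def multistable_levy_motion_def multistable_field_def F_def a_def b_def D_def s_def mult.assoc)
  \<comment> \<open>Only countably many increments enter \<open>Q\<close>, which makes it a
    measurable predicate of the three sequences.\<close>
  define Q where "Q z = (\<not> (\<forall>\<^sub>F n in sequentially. \<bar>F n (fst (fst z)) (snd (fst z)) (snd z)\<bar> \<le> \<epsilon> n))"
    for z :: "((nat \<Rightarrow> real) \<times> (nat \<Rightarrow> real)) \<times> (nat \<Rightarrow> real)"
  let ?S = "PiM UNIV (\<lambda>_::nat. borel :: real measure)"
  have "AE \<omega> in M. Q (((\<lambda>i. \<Gamma> i \<omega>), (\<lambda>i. V i \<omega>)), (\<lambda>i. \<gamma> i \<omega>))"
  proof (rule AE_by_conditioning)
    have [measurable]: "(\<lambda>z. fst (fst z) i) \<in> borel_measurable ((?S \<Otimes>\<^sub>M ?S) \<Otimes>\<^sub>M ?S)"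
      "(\<lambda>z. snd (fst z) i) \<in> borel_measurable ((?S \<Otimes>\<^sub>M ?S) \<Otimes>\<^sub>M ?S)"
      "(\<lambda>z. snd z i) \<in> borel_measurable ((?S \<Otimes>\<^sub>M ?S) \<Otimes>\<^sub>M ?S)" for i
      by (rule measurable_compose[OF _ measurable_component_singleton[of i UNIV]]; simp)+
    have [measurable]: "(\<lambda>z. F n (fst (fst z)) (snd (fst z)) (snd z)) \<in> borel_measurable ((?S \<Otimes>\<^sub>M ?S) \<Otimes>\<^sub>M ?S)" for n
      unfolding F_def a_def b_def by measurable
    show "Measurable.pred ((?S \<Otimes>\<^sub>M ?S) \<Otimes>\<^sub>M ?S) Q"
      unfolding Q_def eventually_sequentially by measurable
    have near: "AE \<omega> in M. \<exists>\<^sub>F i in sequentially. V i \<omega> \<in> {t<..t + r i}"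
      by (rule AE_V_frequently_near) (use t r_pos r_le r_div less_imp_le in auto)
    show "AE \<omega> in M. AE \<sigma> in distr M ?S (\<lambda>\<omega> i. \<gamma> i \<omega>). Q (((\<lambda>i. \<Gamma> i \<omega>), (\<lambda>i. V i \<omega>)), \<sigma>)"
      using near AE_arrival_increasing AE_arrival_linear_growth
    proof eventually_elim
      case (elim \<omega>)
      define G where "G i = \<Gamma> i \<omega>" for i
      define v where "v i = V i \<omega>" for i
      have G: "0 < G i" "G i \<le> G (Suc i)" for i using elim(2) by (auto simp: G_def)
      have G_ge: "\<forall>\<^sub>F i in sequentially. 1 / 4 * real (Suc i) \<le> G i"
        using elim(3) by eventually_elim (simp add: G_def)
      have G_le: "\<forall>\<^sub>F i in sequentially. G i \<le> 4 * real (Suc i)"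
        using elim(3) by eventually_elim (simp add: G_def)
      \<comment> \<open>The value given to \<kappa> is the lower bound of
        \<open>stable_const_ge\<close>, valid for all exponents in (0, d] at once.\<close>
      have jump: "\<forall>\<^sub>F i in sequentially. \<epsilon> i < D (s i) * G i powr (- (1 / \<alpha> (s i)))"
        unfolding \<epsilon>_def r_def D_def
        by (rule eventually_jump_gt[where l = "\<alpha> t" and \<kappa> = "1 / (2 / (2 - d) + 2)"])
          (use \<alpha>_lim \<alpha>s h0 q0 qh t d G_le G stable_const_ge in \<open>auto simp: add_pos_pos\<close>)
      \<comment> \<open>A mark in (t, t + r i] lies outside [0,t] but inside [0, s i]: its term is
        absent from the series at \<open>t\<close> and present in the one at
        \<open>s i\<close>.\<close>
      have freq: "\<exists>\<^sub>F i in sequentially. b G v i = 0 \<and> \<epsilon> i < \<bar>D (s i) * a G v i i\<bar>"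
        using frequently_eventually_frequently[OF elim(1) jump]
      proof (rule frequently_elim1, elim conjE)
        fix i assume "V i \<omega> \<in> {t<..t + r i}" "\<epsilon> i < D (s i) * G i powr (- (1 / \<alpha> (s i)))"
        then show "b G v i = 0 \<and> \<epsilon> i < \<bar>D (s i) * a G v i i\<bar>"
          using t by (auto simp: a_def b_def v_def s_def)
      qed
      have "AE \<omega>' in M. \<not> (\<forall>\<^sub>F n in sequentially. \<bar>F n G v (\<lambda>i. \<gamma> i \<omega>')\<bar> \<le> \<epsilon> n)"
        unfolding F_def
      proof (rule AE_not_eventually_small[where a = "a G v" and b = "b G v" and D = "\<lambda>n. D (s n)" and \<epsilon> = \<epsilon>, OF _ freq])
        fix n
        \<comment> \<open>The bound d < 2 enters here: it puts the decay exponent above the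
          threshold 1/2 for convergence of the sign series.\<close>
        have "1 / 2 < 1 / \<alpha> (s n)" using \<alpha>s[of n] d by (simp add: field_simps)
        then have "AE \<omega>' in M. summable (\<lambda>i. \<gamma> i \<omega>' * indicator {0..s n} (v i) * G i powr (- (1 / \<alpha> (s n))))"
          by (intro AE_summable_arrivals[where \<delta> = "1 / 4"] G G_ge) auto
        then show "AE \<omega>' in M. summable (\<lambda>i. \<gamma> i \<omega>' * a G v n i)"
          by eventually_elim (simp add: a_def mult_ac)
      qed
      moreover have "(\<lambda>\<omega> i. \<gamma> i \<omega>) \<in> measurable M ?S" by (rule measurable_PiM_UNIV) measurable
      moreover have "{\<sigma> \<in> space ?S. \<not> (\<forall>\<^sub>F n in sequentially. \<bar>F n G v \<sigma>\<bar> \<le> \<epsilon> n)} \<in> sets ?S"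
      proof -
        have [measurable]: "(\<lambda>\<sigma>. \<sigma> i) \<in> borel_measurable ?S" for i
          by (rule measurable_component_singleton) simp
        have [measurable]: "F n G v \<in> borel_measurable ?S" for n
          unfolding F_def by measurable
        show ?thesis unfolding eventually_sequentially by measurable
      qed
      ultimately show ?case
        unfolding Q_def G_def v_def by (subst AE_distr_iff) auto
    qed
  qed
  then show ?thesis
  proof eventually_elim
    case (elim \<omega>)
    show ?case
    proof
      assume lim: "((\<lambda>r. \<bar>Y (t + r) \<omega> - Y t \<omega>\<bar> / \<bar>r\<bar> powr h) \<longlongrightarrow> 0) (at 0)"
      have "r n \<noteq> 0" for n using r_pos[of n] by simp
      with r_lim have "filterlim r (at 0) sequentially"
        by (simp add: filterlim_at)
      from filterlim_compose[OF lim this]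
      have "\<forall>\<^sub>F n in sequentially. \<bar>Y (t + r n) \<omega> - Y t \<omega>\<bar> / \<bar>r n\<bar> powr h < 1"
        by (rule order_tendstoD) simp
      then have "\<forall>\<^sub>F n in sequentially. \<bar>F n (\<lambda>i. \<Gamma> i \<omega>) (\<lambda>i. V i \<omega>) (\<lambda>i. \<gamma> i \<omega>)\<bar> \<le> \<epsilon> n"
      proof eventually_elim
        case (elim n)
        then show ?case using r_pos[of n] unfolding Y[symmetric] by (simp add: \<epsilon>_def divide_simps)
      qed
      with elim show False by (simp add: Q_def)
    qed
  qed
qed

end

section \<open>From increments to the Hoelder exponent\<close>

text \<open>For |r| < 1 the power |r|^h decreases in \<open>h\<close>, so an admissible exponent
  makes every smaller one admissible. Hence it suffices to refute countably many exponents
  decreasing to \<open>p\<close>, and countably many null sets can be united.\<close>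

lemma pointwise_holder_exponent_le:
  assumes "\<And>k. \<not> ((\<lambda>r. \<bar>f (t + r) - f t\<bar> / \<bar>r\<bar> powr (p + 1 / real (Suc k))) \<longlongrightarrow> 0) (at 0)"
  shows "pointwise_holder_exponent f t \<le> ereal p"
  unfolding pointwise_holder_exponent_def
proof (rule Sup_least, safe)
  fix h assume h: "((\<lambda>r. \<bar>f (t + r) - f t\<bar> / \<bar>r\<bar> powr h) \<longlongrightarrow> 0) (at 0)"
  have "h \<le> p"
  proof (rule ccontr)
    assume "\<not> h \<le> p"
    then obtain k where k: "1 / real (Suc k) < h - p"
      using reals_Archimedean[of "h - p"] by (auto simp: inverse_eq_divide)
    have "((\<lambda>r. \<bar>f (t + r) - f t\<bar> / \<bar>r\<bar> powr (p + 1 / real (Suc k))) \<longlongrightarrow> 0) (at 0)"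
    proof (rule Lim_null_comparison[OF _ h])
      have "\<forall>\<^sub>F r :: real in at 0. dist r 0 < 1 \<and> r \<noteq> 0"
        by (auto simp: eventually_at intro!: exI[of _ 1])
      then show "\<forall>\<^sub>F r in at 0. norm (\<bar>f (t + r) - f t\<bar> / \<bar>r\<bar> powr (p + 1 / real (Suc k)))
          \<le> \<bar>f (t + r) - f t\<bar> / \<bar>r\<bar> powr h"
      proof eventually_elim
        case (elim r)
        have "\<bar>r\<bar> powr h \<le> \<bar>r\<bar> powr (p + 1 / real (Suc k))"
          using elim k by (intro powr_mono') auto
        then show ?case using elim by (auto intro!: divide_left_mono)
      qed
    qed
    with assms show False by blast
  qed
  then show "ereal h \<le> ereal p" by simp
qed

theorem theorem6:
  fixes M :: "'a measure"
    and \<Gamma> V \<gamma> :: "nat \<Rightarrow> 'a \<Rightarrow> real"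
    and \<alpha> \<alpha>' :: "real \<Rightarrow> real"
    and c d :: real
  assumes "levy_series M \<Gamma> V \<gamma>"
    and "{c..d} \<subseteq> {0<..<2}"
    and "\<alpha> ` {0..1} \<subseteq> {c..d}"
    and "\<And>u. u \<in> {0..1} \<Longrightarrow> (\<alpha> has_real_derivative \<alpha>' u) (at u within {0..1})"
    and "continuous_on {0..1} \<alpha>'"
  shows "\<forall>t\<in>{0<..<1}. AE \<omega> in M.
           pointwise_holder_exponent (\<lambda>s. multistable_levy_motion \<alpha> \<Gamma> V \<gamma> s \<omega>) t
             \<le> ereal (1 / \<alpha> t)"
proof
  fix t :: real assume t: "t \<in> {0<..<1}"
  interpret levy_series M \<Gamma> V \<gamma> by fact
  have range: "\<alpha> u \<in> {c..d}" if "u \<in> {0..1}" for u using assms(3) that by blast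
  have \<alpha>: "0 < \<alpha> u" "\<alpha> u \<le> d" if "u \<in> {0..1}" for u
    using range[OF that] assms(2) by auto
  \<comment> \<open>The interval is nonempty because it contains \<alpha> 0, so its endpoint
    \<open>d\<close> inherits the bound d < 2.\<close>
  have "d \<in> {c..d}" using range[of 0] by simp
  then have d: "d < 2" using assms(2) by auto
  have cont: "continuous_on {0..1} \<alpha>"
    using assms(4) by (rule DERIV_continuous_on)
  have "AE \<omega> in M. \<forall>k. \<not> ((\<lambda>r. \<bar>multistable_levy_motion \<alpha> \<Gamma> V \<gamma> (t + r) \<omega> -
      multistable_levy_motion \<alpha> \<Gamma> V \<gamma> t \<omega>\<bar> / \<bar>r\<bar> powr (1 / \<alpha> t + 1 / real (Suc k))) \<longlongrightarrow> 0) (at 0)"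
    unfolding AE_all_countable
    by (intro allI AE_not_small_increments[OF _ _ \<alpha> d cont]) (use t in auto)
  then show "AE \<omega> in M. pointwise_holder_exponent (\<lambda>s. multistable_levy_motion \<alpha> \<Gamma> V \<gamma> s \<omega>) t
      \<le> ereal (1 / \<alpha> t)"
    by eventually_elim (rule pointwise_holder_exponent_le, simp)
qed

end
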